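(* Let $A\in\mathbb{R}\setminus\{0\}$ and $B,a_0,b_0\in\mathbb{R}$ with $a_0+b_0=B$, and put $a(\epsilon)=a_0+\frac{A}{\epsilon}$, $b(\epsilon)=b_0-\frac{A}{\epsilon}$ for $\epsilon\in(0,1]$; assume $b(\epsilon)\ne0$ for all $\epsilon\in(0,1]$. Let $L>0$, let $0\neq\psi\in L^2(\mathbb{R},dx)$ have support contained in $[-L,L]$, let $p_0=\frac{\pi}{AL}$ and let $q_0\in\mathbb{R}$ satisfy $|q_0p_0|<2\pi$. Suppose there is a constant $\chi>0$ with $\sum_{n\in\mathbb{Z}}|\psi(x+nq_0)|^2=\chi$ for all $x\in\mathbb{R}$. Then for any $f\in L^2(\mathbb{R},dx)$, $$\lim_{\epsilon\to0^+}\sum_{n,m\in\mathbb{Z}}\big|\langle f|\widehat\psi^{\epsilon,a(\epsilon),b(\epsilon)}_{(n,m)}\rangle\big|^2=\sum_{n,m\in\mathbb{Z}}\big|\langle f|\widehat\psi^{A,B}_{(n,m)}\rangle\big|^2.$$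
   Context: $\mathcal{H}=\{f\in L^2(\mathbb{R},dx):\mathcal{F}(f)(w)=0\text{ for } w<0\}$, where $\mathcal{F}(f)(w)=\frac{1}{\sqrt{2\pi}}\int_{\mathbb{R}}f(x)e^{-iwx}dx$. $I:L^2(\mathbb{R},dx)\to\mathcal{H}$ is the unitary operator that is the inverse of $T_1=S_3\circ S_2\circ S_1$, where $S_1:\mathcal{H}\to L^2(\mathbb{R}^+,dx)$, $S_1f=\mathcal{F}(f)|_{\mathbb{R}^+}$; $S_2:L^2(\mathbb{R}^+,dx)\to L^2(\mathbb{R}^+,\frac{dx}{x})$, $(S_2f)(x)=\sqrt{x}f(x)$; $S_3:L^2(\mathbb{R}^+,\frac{dx}{x})\to L^2(\mathbb{R},dx)$, $(S_3f)(x)=f(e^{-x})$. Heisenberg side: $\eta^{A,B}$ is the representation on $L^2(\mathbb{R})$ of the Heisenberg group $H$ ($\mathbb{R}\times\mathbb{R}^2$ with product $(x_1,(y_1,z_1))(x_2,(y_2,z_2))=(x_1+x_2,(y_1+y_2+x_1z_2,z_1+z_2))$) given by $(\eta^{A,B}(c,(v_1,v_2))f)(x)=e^{i[A(v_1+xv_2)+Bv_2]}f(c+x)$; $\widetilde\eta^{A,B}=I\circ\eta^{A,B}\circ I^{-1}$ on $\mathcal{H}$; and $|\widehat\psi^{A,B}_{(n,m)}\rangle=\widetilde\eta^{A,B}\big(nq_0,(\tfrac{nq_0mp_0}{2},mp_0)\big)(I\psi)$. Extended affine side: for $\epsilon\in(0,1]$, $a\in\mathbb{R}$, $b\ne0$,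 $\rho_\epsilon^{a,b}$ is the representation on $L^2(\mathbb{R})$ of $EA=\mathbb{R}^+\times\mathbb{R}\times\mathbb{R}$ (product $(\alpha,\beta,\gamma)(x,y,z)=(\alpha x,\alpha y+\beta,\gamma+z)$) given by $(\rho_\epsilon^{a,b}(\alpha,\beta,\gamma)f)(x)=e^{ia\gamma}e^{ib\beta e^{-\epsilon x}}f\big(x-\tfrac{\log\alpha}{\epsilon}\big)$; $\pi_\epsilon^{a,b}=I\circ\rho_\epsilon^{a,b}\circ I^{-1}$ on $\mathcal{H}$. Put $\alpha_n(\epsilon)=e^{-\epsilon nq_0}$, $\beta_{mn}(\epsilon)=-\frac{2\pi m\,e^{-\epsilon nq_0}}{b(\epsilon)(e^{\epsilon L}-e^{-\epsilon L})}$, $\gamma_{mn}(\epsilon)=\beta_{mn}(\epsilon)\frac{\ln\alpha_n(\epsilon)}{\alpha_n(\epsilon)-1}$ (the quotient is $1$ when $\alpha_n(\epsilon)=1$), $Q_\epsilon(x)=e^{-\frac12\epsilon x}$, and $|\widehat\psi^{\epsilon,a(\epsilon),b(\epsilon)}_{(n,m)}\rangle=\pi_\epsilon^{a(\epsilon),b(\epsilon)}(\alpha_n(\epsilon),\beta_{mn}(\epsilon),\gamma_{mn}(\epsilon))(I(Q_\epsilon\psi))$. *)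

theory Defs
  imports "HOL-Analysis.Analysis"
begin

text \<open>
  Elements of \<open>L\<^sup>2(\<real>, dx)\<close> are handled through Borel representatives
  \<open>real \<Rightarrow> complex\<close>; equality in \<open>L\<^sup>2\<close> is equality almost everywhere.
\<close>

definition L2 :: "(real \<Rightarrow> complex) set" where
  "L2 = {f \<in> borel_measurable lborel. integrable lborel (\<lambda>x. (cmod (f x))\<^sup>2)}"

definition braket :: "(real \<Rightarrow> complex) \<Rightarrow> (real \<Rightarrow> complex) \<Rightarrow> complex" where
  "braket f g = (LINT x|lborel. cnj (f x) * g x)"

definition fourier_integral :: "(real \<Rightarrow> complex) \<Rightarrow> real \<Rightarrow> complex" where
  "fourier_integral f w = of_real (1 / sqrt (2 * pi)) * (LINT x|lborel. f x * cis (- (w * x)))"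

text \<open>
  For \<open>f \<in> L\<^sup>2\<close> the integral above need not converge, so the transform of \<open>f\<close> is
  the \<open>L\<^sup>2\<close> limit of the transforms of the truncations of \<open>f\<close> to \<open>[-R, R]\<close>.
  It is determined up to null sets; \<open>\<F>\<close> picks a representative.
\<close>

definition is_fourier_transform :: "(real \<Rightarrow> complex) \<Rightarrow> (real \<Rightarrow> complex) \<Rightarrow> bool" where
  "is_fourier_transform f g \<longleftrightarrow> g \<in> L2 \<and>
     ((\<lambda>R. \<integral>\<^sup>+ w. ennreal ((cmod (fourier_integral (\<lambda>x. indicator {-R..R} x * f x) w - g w))\<^sup>2)
        \<partial>lborel) \<longlongrightarrow> 0) at_top"

definition \<F> :: "(real \<Rightarrow> complex) \<Rightarrow> real \<Rightarrow> complex" where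
  "\<F> f = (SOME g. is_fourier_transform f g)"

definition \<H> :: "(real \<Rightarrow> complex) set" where
  "\<H> = {f \<in> L2. AE w in lborel. w < 0 \<longrightarrow> \<F> f w = 0}"

text \<open>Functions on \<open>\<real>\<^sup>+\<close> are extended by \<open>0\<close> to the whole line.\<close>

definition S1 :: "(real \<Rightarrow> complex) \<Rightarrow> real \<Rightarrow> complex" where
  "S1 f = (\<lambda>x. if x > 0 then \<F> f x else 0)"

definition S2 :: "(real \<Rightarrow> complex) \<Rightarrow> real \<Rightarrow> complex" where
  "S2 f = (\<lambda>x. if x > 0 then of_real (sqrt x) * f x else 0)"

definition S3 :: "(real \<Rightarrow> complex) \<Rightarrow> real \<Rightarrow> complex" where
  "S3 f = (\<lambda>x. f (exp (- x)))"

definition T1 :: "(real \<Rightarrow> complex) \<Rightarrow> real \<Rightarrow> complex" where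
  "T1 = S3 \<circ> S2 \<circ> S1"

text \<open>
  The inverse of \<open>T1 : \<H> \<rightarrow> L\<^sup>2(\<real>)\<close>: \<open>I_op g\<close> is the element \<open>h\<close> of \<open>\<H>\<close>, unique up to
  null sets, with \<open>T1 h = g\<close> in \<open>L\<^sup>2\<close>.
\<close>

definition I_op :: "(real \<Rightarrow> complex) \<Rightarrow> real \<Rightarrow> complex" where
  "I_op g = (SOME h. h \<in> \<H> \<and> (AE x in lborel. T1 h x = g x))"

fun \<eta> :: "real \<Rightarrow> real \<Rightarrow> real \<times> real \<times> real \<Rightarrow> (real \<Rightarrow> complex) \<Rightarrow> real \<Rightarrow> complex" where
  "\<eta> A B (c, v1, v2) f = (\<lambda>x. cis (A * (v1 + x * v2) + B * v2) * f (c + x))"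

text \<open>\<open>T1\<close> is the inverse of \<open>I_op\<close>, so the next definition is \<open>I \<circ> \<eta> \<circ> I\<^sup>-\<^sup>1\<close>;
  likewise for \<open>\<pi>_rep\<close> below.\<close>

definition \<eta>_tilde :: "real \<Rightarrow> real \<Rightarrow> real \<times> real \<times> real \<Rightarrow> (real \<Rightarrow> complex) \<Rightarrow> real \<Rightarrow> complex" where
  "\<eta>_tilde A B g = I_op \<circ> \<eta> A B g \<circ> T1"

definition \<psi>_heis ::
  "real \<Rightarrow> real \<Rightarrow> real \<Rightarrow> real \<Rightarrow> (real \<Rightarrow> complex) \<Rightarrow> int \<Rightarrow> int \<Rightarrow> real \<Rightarrow> complex" where
  "\<psi>_heis A B q0 p0 \<psi> n m =
     \<eta>_tilde A B (of_int n * q0, of_int n * q0 * of_int m * p0 / 2, of_int m * p0) (I_op \<psi>)"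

fun \<rho> :: "real \<Rightarrow> real \<Rightarrow> real \<Rightarrow> real \<times> real \<times> real \<Rightarrow> (real \<Rightarrow> complex) \<Rightarrow> real \<Rightarrow> complex" where
  "\<rho> \<epsilon> a b (\<alpha>, \<beta>, \<gamma>) f =
     (\<lambda>x. cis (a * \<gamma>) * cis (b * \<beta> * exp (- \<epsilon> * x)) * f (x - ln \<alpha> / \<epsilon>))"

definition \<pi>_rep ::
  "real \<Rightarrow> real \<Rightarrow> real \<Rightarrow> real \<times> real \<times> real \<Rightarrow> (real \<Rightarrow> complex) \<Rightarrow> real \<Rightarrow> complex" where
  "\<pi>_rep \<epsilon> a b g = I_op \<circ> \<rho> \<epsilon> a b g \<circ> T1"

definition \<alpha>_par :: "real \<Rightarrow> real \<Rightarrow> int \<Rightarrow> real" where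
  "\<alpha>_par q0 \<epsilon> n = exp (- \<epsilon> * of_int n * q0)"

definition \<beta>_par :: "real \<Rightarrow> real \<Rightarrow> real \<Rightarrow> real \<Rightarrow> int \<Rightarrow> int \<Rightarrow> real" where
  "\<beta>_par L q0 b \<epsilon> n m =
     - (2 * pi * of_int m * exp (- \<epsilon> * of_int n * q0)) / (b * (exp (\<epsilon> * L) - exp (- \<epsilon> * L)))"

definition \<gamma>_par :: "real \<Rightarrow> real \<Rightarrow> real \<Rightarrow> real \<Rightarrow> int \<Rightarrow> int \<Rightarrow> real" where
  "\<gamma>_par L q0 b \<epsilon> n m = \<beta>_par L q0 b \<epsilon> n m *
     (if \<alpha>_par q0 \<epsilon> n = 1 then 1 else ln (\<alpha>_par q0 \<epsilon> n) / (\<alpha>_par q0 \<epsilon> n - 1))"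

definition Q :: "real \<Rightarrow> real \<Rightarrow> real" where
  "Q \<epsilon> x = exp (- (1 / 2) * \<epsilon> * x)"

definition \<psi>_aff ::
  "real \<Rightarrow> real \<Rightarrow> real \<Rightarrow> real \<Rightarrow> real \<Rightarrow> (real \<Rightarrow> complex) \<Rightarrow> int \<Rightarrow> int \<Rightarrow> real \<Rightarrow> complex" where
  "\<psi>_aff L q0 \<epsilon> a b \<psi> n m =
     \<pi>_rep \<epsilon> a b (\<alpha>_par q0 \<epsilon> n, \<beta>_par L q0 b \<epsilon> n m, \<gamma>_par L q0 b \<epsilon> n m)
       (I_op (\<lambda>x. of_real (Q \<epsilon> x) * \<psi> x))"

end

theory Submission
  imports Defs
begin

text \<open>
  Since \<open>I\<close> is unitary onto \<open>\<H>\<close>, the coefficients of \<open>f\<close> are integrals of \<open>cnj h\<close>, where \<open>h = T1 f\<close>,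
  against translates of \<open>\<psi>\<close> carrying oscillating factors. In the variable \<open>x\<close> (Heisenberg case) or
  \<open>u = exp (- \<epsilon> y)\<close> (affine case, where \<open>Q \<epsilon>\<close> is exactly the square root of the Jacobian) these factors
  are the Fourier basis of an interval carrying the support, so Parseval's identity evaluates the sum
  over \<open>m\<close>; the periodization condition then evaluates the sum over \<open>n\<close>. Both families are thus tight:
  the double sums are \<open>2 L \<chi> \<parallel>h\<parallel>\<^sup>2\<close> and \<open>(exp (\<epsilon> L) - exp (- \<epsilon> L)) / \<epsilon> * \<chi> \<parallel>h\<parallel>\<^sup>2\<close>, and the latter
  tends to the former. Parseval's identity rests on Stone--Weierstrass, and integrating it over
  shifts of the frequency lattice gives Plancherel's theorem for functions of bounded support.
\<close>

section \<open>Square-integrable functions\<close>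

text \<open>\<open>\<F>\<close> and \<open>I_op\<close> are chosen by \<open>SOME\<close>, so
  nothing is known about them until witnesses exist: a transform comes from completeness of L2 and
  the isometry on truncations, a preimage under \<open>T1\<close> from surjectivity of the
  transform. Both remain determined only up to null sets, hence the phrasing through
  almost-everywhere equality, \<open>sqnorm\<close> and \<open>inner_L2\<close>.

  The function \<open>f\<close> need not lie in \<open>\<H>\<close>. Elements of \<open>\<H>\<close>
  pair only with its positive frequencies, and these are what \<open>T1 f\<close> records.

  The product of \<open>cnj h\<close> with a translate of \<open>\<psi>\<close> is a priori only
  integrable. The periodization condition bounds each translate by \<open>sqrt chi\<close> almost
  everywhere; this makes the product square-integrable, as Parseval's identity requires.

  The constant 2 L is the length of the interval whose Fourier frequencies are pi m / L; the factor
  1 / \<epsilon> in the affine constant comes from du = - \<epsilon> u dy. Sums are computed as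
  integrals against counting measure, where Tonelli permits every interchange.\<close>

definition square_integrable :: "'a measure \<Rightarrow> ('a \<Rightarrow> complex) \<Rightarrow> bool" where
  "square_integrable M f \<longleftrightarrow> f \<in> borel_measurable M \<and> integrable M (\<lambda>x. (cmod (f x))\<^sup>2)"

text \<open>Conjugate-linear in the first argument, like \<open>braket\<close>. The general measure
  serves both \<open>lborel\<close> on the line and \<open>M01\<close> on the unit interval.\<close>

definition inner_L2 :: "'a measure \<Rightarrow> ('a \<Rightarrow> complex) \<Rightarrow> ('a \<Rightarrow> complex) \<Rightarrow> complex" where
  "inner_L2 M f g = (LINT x|M. cnj (f x) * g x)"

definition sqnorm :: "'a measure \<Rightarrow> ('a \<Rightarrow> complex) \<Rightarrow> real" where
  "sqnorm M f = (LINT x|M. (cmod (f x))\<^sup>2)"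

lemma borel_measurable_cnj [measurable]:
  "f \<in> borel_measurable M \<Longrightarrow> (\<lambda>x. cnj (f x)) \<in> borel_measurable M"
  by (rule measurable_compose[OF _ borel_measurable_continuous_onI]) (auto intro!: continuous_intros)

lemma square_integrable_measurable [measurable_dest]:
  "square_integrable M f \<Longrightarrow> f \<in> borel_measurable M"
  by (simp add: square_integrable_def)

lemma square_integrableD: "square_integrable M f \<Longrightarrow> integrable M (\<lambda>x. (cmod (f x))\<^sup>2)"
  by (simp add: square_integrable_def)

lemma square_integrable_bound:
  assumes "square_integrable M f" and [measurable]: "g \<in> borel_measurable M"
    and "AE x in M. cmod (g x) \<le> C * cmod (f x)"
  shows "square_integrable M g"
  unfolding square_integrable_def
proof
  show "integrable M (\<lambda>x. (cmod (g x))\<^sup>2)"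
  proof (rule Bochner_Integration.integrable_bound)
    show "integrable M (\<lambda>x. C\<^sup>2 * (cmod (f x))\<^sup>2)"
      using square_integrableD[OF assms(1)] by simp
    show "AE x in M. norm ((cmod (g x))\<^sup>2) \<le> norm (C\<^sup>2 * (cmod (f x))\<^sup>2)"
      using assms(3)
    proof eventually_elim
      case (elim x)
      from power_mono[OF elim, of 2] show ?case by (simp add: power_mult_distrib)
    qed
  qed measurable
qed fact

lemma square_integrable_mult_integrable:
  assumes "square_integrable M f" "square_integrable M g"
  shows "integrable M (\<lambda>x. f x * g x)"
proof (rule Bochner_Integration.integrable_bound)
  note [measurable] = assms[THEN square_integrable_measurable]
  show "integrable M (\<lambda>x. (cmod (f x))\<^sup>2 + (cmod (g x))\<^sup>2)"
    using assms by (auto dest: square_integrableD)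
  show "(\<lambda>x. f x * g x) \<in> borel_measurable M" by measurable
  have "cmod (f x) * cmod (g x) \<le> (cmod (f x))\<^sup>2 + (cmod (g x))\<^sup>2" for x
    using sum_squares_bound[of "cmod (f x)" "cmod (g x)"]
      mult_nonneg_nonneg[OF norm_ge_zero norm_ge_zero, of "f x" "g x"] by linarith
  then show "AE x in M. norm (f x * g x) \<le> norm ((cmod (f x))\<^sup>2 + (cmod (g x))\<^sup>2)"
    by (auto simp: norm_mult)
qed

lemma square_integrable_cnj [simp]:
  "square_integrable M f \<Longrightarrow> square_integrable M (\<lambda>x. cnj (f x))"
  by (auto simp: square_integrable_def)

lemma integrable_inner_L2:
  "square_integrable M f \<Longrightarrow> square_integrable M g \<Longrightarrow> integrable M (\<lambda>x. cnj (f x) * g x)"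
  by (intro square_integrable_mult_integrable square_integrable_cnj)

lemma square_integrable_cmult [simp]:
  "square_integrable M f \<Longrightarrow> square_integrable M (\<lambda>x. c * f x)"
  by (auto simp: square_integrable_def norm_mult power_mult_distrib)

lemma square_integrable_zero [simp]: "square_integrable M (\<lambda>x. 0)"
  by (auto simp: square_integrable_def)

lemma cmod_add_square:
  "(cmod (z + w))\<^sup>2 = (cmod z)\<^sup>2 + (cmod w)\<^sup>2 + 2 * Re (cnj z * w)"
  unfolding cmod_power2 by (simp add: power2_eq_square algebra_simps)

lemma square_integrable_add [simp]:
  assumes "square_integrable M f" "square_integrable M g"
  shows "square_integrable M (\<lambda>x. f x + g x)"
proof -
  have "integrable M (\<lambda>x. (cmod (f x))\<^sup>2 + (cmod (g x))\<^sup>2 + 2 * Re (cnj (f x) * g x))"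
    by (intro Bochner_Integration.integrable_add integrable_mult_right integrable_Re
        integrable_inner_L2 square_integrableD assms)
  with assms show ?thesis
    unfolding square_integrable_def cmod_add_square by auto
qed

lemma square_integrable_diff [simp]:
  assumes "square_integrable M f" "square_integrable M g"
  shows "square_integrable M (\<lambda>x. f x - g x)"
  using square_integrable_add[OF assms(1) square_integrable_cmult[OF assms(2), of "-1"]] by simp

lemma square_integrable_sum [simp]:
  "(\<And>i. i \<in> I \<Longrightarrow> square_integrable M (f i)) \<Longrightarrow> square_integrable M (\<lambda>x. \<Sum>i\<in>I. f i x)"
  by (induction I rule: infinite_finite_induct) auto

lemma sqnorm_nonneg [simp]: "0 \<le> sqnorm M f"
  by (simp add: sqnorm_def)

lemma sqnorm_cmult [simp]: "sqnorm M (\<lambda>x. c * f x) = (cmod c)\<^sup>2 * sqnorm M f"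
  by (simp add: sqnorm_def norm_mult power_mult_distrib)

lemma sqnorm_cnj [simp]: "sqnorm M (\<lambda>x. cnj (f x)) = sqnorm M f"
  by (simp add: sqnorm_def)

lemma sqnorm_minus_commute: "sqnorm M (\<lambda>x. f x - g x) = sqnorm M (\<lambda>x. g x - f x)"
  by (simp add: sqnorm_def norm_minus_commute)

lemma nn_integral_sqnorm:
  "square_integrable M f \<Longrightarrow> (\<integral>\<^sup>+x. ennreal ((cmod (f x))\<^sup>2) \<partial>M) = ennreal (sqnorm M f)"
  unfolding sqnorm_def by (rule nn_integral_eq_integral) (auto dest: square_integrableD)

lemma square_integrableI_nn:
  assumes [measurable]: "f \<in> borel_measurable M"
    and "(\<integral>\<^sup>+x. ennreal ((cmod (f x))\<^sup>2) \<partial>M) < \<infinity>"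
  shows "square_integrable M f"
  unfolding square_integrable_def using assms
  by (auto intro!: integrableI_nonneg)

lemma sqnorm_add:
  assumes "square_integrable M f" "square_integrable M g"
  shows "sqnorm M (\<lambda>x. f x + g x) = sqnorm M f + sqnorm M g + 2 * Re (inner_L2 M f g)"
proof -
  note I = integrable_inner_L2[OF assms]
  have "sqnorm M (\<lambda>x. f x + g x)
      = (LINT x|M. (cmod (f x))\<^sup>2 + (cmod (g x))\<^sup>2 + 2 * Re (cnj (f x) * g x))"
    unfolding sqnorm_def cmod_add_square ..
  also have "\<dots> = sqnorm M f + sqnorm M g + 2 * (LINT x|M. Re (cnj (f x) * g x))"
    using assms[THEN square_integrableD] integrable_Re[OF I]
    unfolding sqnorm_def
    by (simp del: times_complex.sel complex_cnj_mult)
  also have "(LINT x|M. Re (cnj (f x) * g x)) = Re (inner_L2 M f g)"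
    unfolding inner_L2_def using I by (rule integral_Re)
  finally show ?thesis .
qed

lemma inner_L2_cmult_right [simp]: "inner_L2 M f (\<lambda>x. c * g x) = c * inner_L2 M f g"
proof -
  have "inner_L2 M f (\<lambda>x. c * g x) = (LINT x|M. c * (cnj (f x) * g x))"
    unfolding inner_L2_def by (simp add: mult_ac)
  then show ?thesis unfolding inner_L2_def by simp
qed

lemma inner_L2_commute: "inner_L2 M g f = cnj (inner_L2 M f g)"
  unfolding inner_L2_def by (subst Bochner_Integration.integral_cnj[symmetric]) (simp add: mult.commute)

lemma inner_L2_cmult_left [simp]: "inner_L2 M (\<lambda>x. c * f x) g = cnj c * inner_L2 M f g"
  by (subst inner_L2_commute) (simp flip: inner_L2_commute)

lemma inner_L2_diff_right:
  assumes "square_integrable M f" "square_integrable M g" "square_integrable M h"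
  shows "inner_L2 M f (\<lambda>x. g x - h x) = inner_L2 M f g - inner_L2 M f h"
  using assms integrable_inner_L2[of M f]
  by (simp add: inner_L2_def right_diff_distrib)

lemma inner_L2_diff_left:
  assumes "square_integrable M f" "square_integrable M g" "square_integrable M h"
  shows "inner_L2 M (\<lambda>x. f x - g x) h = inner_L2 M f h - inner_L2 M g h"
  using assms by (subst inner_L2_commute) (simp add: inner_L2_diff_right flip: inner_L2_commute)

lemma inner_L2_self: "inner_L2 M f f = of_real (sqnorm M f)"
  unfolding inner_L2_def sqnorm_def
  by (simp add: complex_norm_square mult.commute del: of_real_power flip: integral_complex_of_real)

lemma sqnorm_diff:
  assumes "square_integrable M f" "square_integrable M g"
  shows "sqnorm M (\<lambda>x. f x - g x) = sqnorm M f + sqnorm M g - 2 * Re (inner_L2 M f g)"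
  using sqnorm_add[OF assms(1) square_integrable_cmult[OF assms(2), of "-1"]]
    inner_L2_cmult_right[of M f "-1" g] sqnorm_cmult[of M "-1" g] by simp

text \<open>Parallelogram identity with one term dropped. The factor 2 is the price for a triangle
  inequality on squared norms, without square roots.\<close>

lemma sqnorm_add_le:
  assumes "square_integrable M f" "square_integrable M g"
  shows "sqnorm M (\<lambda>x. f x + g x) \<le> 2 * sqnorm M f + 2 * sqnorm M g"
  using sqnorm_add[OF assms] sqnorm_diff[OF assms] sqnorm_nonneg[of M "\<lambda>x. f x - g x"] by linarith

lemma sqnorm_triangle:
  assumes "square_integrable M f" "square_integrable M g" "square_integrable M h"
  shows "sqnorm M (\<lambda>x. f x - h x) \<le> 2 * sqnorm M (\<lambda>x. f x - g x) + 2 * sqnorm M (\<lambda>x. g x - h x)"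
  using sqnorm_add_le[of M "\<lambda>x. f x - g x" "\<lambda>x. g x - h x"] assms by simp

lemma sqnorm_eq_0_iff:
  assumes "square_integrable M f"
  shows "sqnorm M f = 0 \<longleftrightarrow> (AE x in M. f x = 0)"
  unfolding sqnorm_def using assms
  by (subst integral_nonneg_eq_0_iff_AE) (auto dest: square_integrableD)

lemma Cauchy_Schwarz_L2:
  assumes f: "square_integrable M f" and g: "square_integrable M g"
  shows "(cmod (inner_L2 M f g))\<^sup>2 \<le> sqnorm M f * sqnorm M g"
proof (cases "sqnorm M g = 0")
  case True
  have "inner_L2 M f g = (LINT x|M. 0)"
    unfolding inner_L2_def
  proof (rule integral_cong_AE)
    show "(\<lambda>x. cnj (f x) * g x) \<in> borel_measurable M" using f g by measurable
    show "AE x in M. cnj (f x) * g x = 0"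
      using True sqnorm_eq_0_iff[OF g] by auto
  qed auto
  then show ?thesis using True by simp
next
  case False
  define N where "N = sqnorm M g"
  \<comment> \<open>The coefficient of the orthogonal projection of \<open>f\<close> onto the line
    spanned by \<open>g\<close>; nonnegativity of the remaining squared distance is the
    inequality.\<close>
  define c where "c = cnj (inner_L2 M f g) / N"
  from False have N: "N > 0" unfolding N_def using sqnorm_nonneg[of M g] by linarith
  have "0 \<le> sqnorm M (\<lambda>x. f x - c * g x)" by simp
  also have "\<dots> = sqnorm M f + (cmod c)\<^sup>2 * N - 2 * Re (c * inner_L2 M f g)"
    using f g by (subst sqnorm_diff) (auto simp: N_def)
  also have "c * inner_L2 M f g = complex_of_real ((cmod (inner_L2 M f g))\<^sup>2 / N)"
    unfolding c_def by (simp add: complex_norm_square mult.commute del: of_real_power)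
  also have "(cmod c)\<^sup>2 * N = (cmod (inner_L2 M f g))\<^sup>2 / N"
    unfolding c_def using N by (simp add: norm_divide power2_eq_square)
  finally have "0 \<le> sqnorm M f - (cmod (inner_L2 M f g))\<^sup>2 / N" by simp
  then show ?thesis using N unfolding N_def[symmetric]
    by (simp add: field_simps)
qed

text \<open>Lets preservation of norms imply preservation of inner products, which is how
  \<open>Plancherel\<close> is obtained.\<close>

lemma polarization_L2:
  assumes "square_integrable M f" "square_integrable M g"
  shows "inner_L2 M f g =
    Complex ((sqnorm M (\<lambda>x. f x + g x) - sqnorm M f - sqnorm M g) / 2)
      ((sqnorm M f + sqnorm M g - sqnorm M (\<lambda>x. f x + \<i> * g x)) / 2)"
  using sqnorm_add[OF assms] sqnorm_add[OF assms(1) square_integrable_cmult[OF assms(2)], of "\<i>"]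
  by (simp add: complex_eq_iff)

lemma tendsto_inner_L2:
  fixes F :: "'b filter"
  assumes f: "square_integrable M f" "\<And>i. square_integrable M (u i)"
    and g: "square_integrable M g" "\<And>i. square_integrable M (v i)"
    and u: "((\<lambda>i. sqnorm M (\<lambda>x. u i x - f x)) \<longlongrightarrow> 0) F"
    and v: "((\<lambda>i. sqnorm M (\<lambda>x. v i x - g x)) \<longlongrightarrow> 0) F"
  shows "((\<lambda>i. inner_L2 M (u i) (v i)) \<longlongrightarrow> inner_L2 M f g) F"
proof -
  let ?U = "\<lambda>i. sqnorm M (\<lambda>x. u i x - f x)" and ?V = "\<lambda>i. sqnorm M (\<lambda>x. v i x - g x)"
  have CS: "cmod (inner_L2 M a b) \<le> sqrt (sqnorm M a) * sqrt (sqnorm M b)"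
    if "square_integrable M a" "square_integrable M b" for a b
    using Cauchy_Schwarz_L2[OF that] by (simp add: real_le_rsqrt flip: real_sqrt_mult)
  \<comment> \<open>Every term now contains at least one difference that tends to zero.\<close>
  have "inner_L2 M (u i) (v i) - inner_L2 M f g =
      inner_L2 M (\<lambda>x. u i x - f x) (\<lambda>x. v i x - g x) + inner_L2 M (\<lambda>x. u i x - f x) g
      + inner_L2 M f (\<lambda>x. v i x - g x)" for i
    using f g by (simp add: inner_L2_diff_left inner_L2_diff_right)
  then have "cmod (inner_L2 M (u i) (v i) - inner_L2 M f g) \<le>
     cmod (inner_L2 M (\<lambda>x. u i x - f x) (\<lambda>x. v i x - g x))
      + cmod (inner_L2 M (\<lambda>x. u i x - f x) g) + cmod (inner_L2 M f (\<lambda>x. v i x - g x))" for i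
    by (metis (no_types, lifting) add_mono norm_triangle_ineq norm_triangle_mono order_refl)
  also have "\<dots> i \<le> sqrt (?U i) * sqrt (?V i) + sqrt (?U i) * sqrt (sqnorm M g)
      + sqrt (sqnorm M f) * sqrt (?V i)" for i
    using f g by (intro add_mono CS) auto
  finally have le: "cmod (inner_L2 M (u i) (v i) - inner_L2 M f g) \<le> sqrt (?U i) * sqrt (?V i)
      + sqrt (?U i) * sqrt (sqnorm M g) + sqrt (sqnorm M f) * sqrt (?V i)" for i .
  have "((\<lambda>i. sqrt (?U i) * sqrt (?V i) + sqrt (?U i) * sqrt (sqnorm M g)
      + sqrt (sqnorm M f) * sqrt (?V i)) \<longlongrightarrow>
      sqrt 0 * sqrt 0 + sqrt 0 * sqrt (sqnorm M g) + sqrt (sqnorm M f) * sqrt 0) F"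
    by (intro tendsto_intros u v)
  then have "((\<lambda>i. inner_L2 M (u i) (v i) - inner_L2 M f g) \<longlongrightarrow> 0) F"
    by (intro Lim_null_comparison[OF always_eventually[OF allI[OF le]]]) simp
  then show ?thesis by (simp only: LIM_zero_iff)
qed

lemma tendsto_sqnorm:
  fixes F :: "'b filter"
  assumes "square_integrable M f" "\<And>i. square_integrable M (u i)"
    and "((\<lambda>i. sqnorm M (\<lambda>x. u i x - f x)) \<longlongrightarrow> 0) F"
  shows "((\<lambda>i. sqnorm M (u i)) \<longlongrightarrow> sqnorm M f) F"
  using tendsto_Re[OF tendsto_inner_L2[OF assms(1,2,1,2,3,3)]] by (simp add: inner_L2_self)

lemma tendsto_sqnorm_add:
  fixes F :: "'b filter"
  assumes "square_integrable M f" "\<And>i. square_integrable M (u i)"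
    and "square_integrable M g" "\<And>i. square_integrable M (v i)"
    and "((\<lambda>i. sqnorm M (\<lambda>x. u i x - f x)) \<longlongrightarrow> 0) F"
    and "((\<lambda>i. sqnorm M (\<lambda>x. v i x - g x)) \<longlongrightarrow> 0) F"
  shows "((\<lambda>i. sqnorm M (\<lambda>x. (u i x + c * v i x) - (f x + c * g x))) \<longlongrightarrow> 0) F"
proof (rule tendsto_sandwich[OF always_eventually _ tendsto_const])
  have "sqnorm M (\<lambda>x. (u i x + c * v i x) - (f x + c * g x)) \<le>
     2 * sqnorm M (\<lambda>x. u i x - f x) + 2 * ((cmod c)\<^sup>2 * sqnorm M (\<lambda>x. v i x - g x))" for i
    using sqnorm_add_le[of M "\<lambda>x. u i x - f x" "\<lambda>x. c * (v i x - g x)"] assms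
    by (simp add: algebra_simps del: sqnorm_cmult) (simp add: sqnorm_cmult flip: right_diff_distrib)
  then show "\<forall>\<^sub>F i in F. sqnorm M (\<lambda>x. (u i x + c * v i x) - (f x + c * g x)) \<le>
     2 * sqnorm M (\<lambda>x. u i x - f x) + 2 * ((cmod c)\<^sup>2 * sqnorm M (\<lambda>x. v i x - g x))" by simp
  show "((\<lambda>i. 2 * sqnorm M (\<lambda>x. u i x - f x) + 2 * ((cmod c)\<^sup>2 * sqnorm M (\<lambda>x. v i x - g x))) \<longlongrightarrow> 0) F"
    using assms(5,6) by (intro tendsto_eq_intros) auto
qed auto

text \<open>Riesz--Fischer: a rapidly converging subsequence has a pointwise limit almost
  everywhere, and Fatou's lemma turns it into a limit in norm.\<close>

lemma square_integrable_complete: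
  fixes u :: "nat \<Rightarrow> 'a \<Rightarrow> complex"
  assumes u: "\<And>n. square_integrable M (u n)"
    and Cauchy: "\<And>e. e > 0 \<Longrightarrow> \<exists>N. \<forall>m\<ge>N. \<forall>n\<ge>N. sqnorm M (\<lambda>x. u m x - u n x) < e"
  shows "\<exists>g. square_integrable M g \<and> (\<lambda>n. sqnorm M (\<lambda>x. u n x - g x)) \<longlonglongrightarrow> 0"
proof -
  note [measurable] = u[THEN square_integrable_measurable]
  \<comment> \<open>The rate 1/4 leaves room for weights 2^k: the weighted squares of the increments
    still have finite total integral, so almost everywhere the increments are dominated by a
    geometric series of ratio 1 / sqrt 2.\<close>
  have "\<exists>N. \<forall>m\<ge>N. \<forall>n\<ge>N. sqnorm M (\<lambda>x. u m x - u n x) < (1/4)^k" for k :: nat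
    by (rule Cauchy) simp
  then obtain N where N: "\<And>k m n. m \<ge> N k \<Longrightarrow> n \<ge> N k \<Longrightarrow> sqnorm M (\<lambda>x. u m x - u n x) < (1/4)^k"
    by metis
  \<comment> \<open>The sum forces \<open>r k\<close> to be at least \<open>N k\<close> and
    monotone; the summand \<open>k\<close> makes it unbounded.\<close>
  define r where "r k = k + (\<Sum>i\<le>k. N i)" for k
  have rN: "N k \<le> r k" for k
  proof -
    have "N k \<le> (\<Sum>i\<le>k. N i)" by (rule member_le_sum) auto
    then show ?thesis by (simp add: r_def)
  qed
  have r_Suc: "r k \<le> r (Suc k)" for k by (simp add: r_def)
  have r_ge: "k \<le> r k" for k by (simp add: r_def)
  define d where "d k x = u (r (Suc k)) x - u (r k) x" for k x
  have [measurable]: "d k \<in> borel_measurable M" for k unfolding d_def by measurable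
  have sd: "square_integrable M (d k)" for k unfolding d_def using u by simp
  have d_le: "sqnorm M (d k) \<le> (1/4)^k" for k
    unfolding d_def using N[of k "r (Suc k)" "r k"] rN[of k] r_Suc[of k] by fastforce
  have "(\<integral>\<^sup>+x. (\<Sum>k. ennreal (2^k * (cmod (d k x))\<^sup>2)) \<partial>M)
      = (\<Sum>k. \<integral>\<^sup>+x. ennreal (2^k * (cmod (d k x))\<^sup>2) \<partial>M)"
    by (rule nn_integral_suminf) measurable
  also have "(\<lambda>k. \<integral>\<^sup>+x. ennreal (2^k * (cmod (d k x))\<^sup>2) \<partial>M) = (\<lambda>k. ennreal (2^k * sqnorm M (d k)))"
    by (intro ext) (simp add: ennreal_mult nn_integral_cmult nn_integral_sqnorm[OF sd])
  also have "(\<Sum>k. ennreal (2^k * sqnorm M (d k))) \<le> (\<Sum>k. ennreal ((1/2)^k))"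
  proof (intro suminf_le summableI ennreal_leI)
    fix k :: nat
    have "2^k * sqnorm M (d k) \<le> 2^k * (1/4)^k" by (intro mult_left_mono d_le) auto
    also have "\<dots> = (2 * (1/4))^k" by (rule power_mult_distrib[symmetric])
    also have "\<dots> = (1/2)^k" by simp
    finally show "2^k * sqnorm M (d k) \<le> (1/2)^k" .
  qed
  also have "\<dots> = ennreal (\<Sum>k. (1/2)^k)"
    by (rule suminf_ennreal2) (auto intro: summable_geometric)
  finally have "(\<integral>\<^sup>+x. (\<Sum>k. ennreal (2^k * (cmod (d k x))\<^sup>2)) \<partial>M) \<noteq> \<infinity>"
    by (auto simp: top_unique)
  then have "AE x in M. (\<Sum>k. ennreal (2^k * (cmod (d k x))\<^sup>2)) \<noteq> \<infinity>"
    by (intro nn_integral_PInf_AE) measurable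
  then have conv: "AE x in M. convergent (\<lambda>k. u (r k) x)"
  proof eventually_elim
    case (elim x)
    define C where "C = enn2real (\<Sum>k. ennreal (2^k * (cmod (d k x))\<^sup>2))"
    have lt: "(\<Sum>k. ennreal (2^k * (cmod (d k x))\<^sup>2)) < top"
      using elim by (simp only: infinity_ennreal_def less_top)
    have C: "(\<Sum>k. ennreal (2^k * (cmod (d k x))\<^sup>2)) = ennreal C" "C \<ge> 0"
      unfolding C_def using ennreal_enn2real[OF lt] by (simp_all only: enn2real_nonneg)
    have "norm (d k x) \<le> sqrt C * (1 / sqrt 2)^k" for k
    proof -
      have "(\<Sum>j\<in>{k}. ennreal (2^j * (cmod (d j x))\<^sup>2)) \<le> (\<Sum>j. ennreal (2^j * (cmod (d j x))\<^sup>2))"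
        by (rule sum_le_suminf[OF summableI]) auto
      then have "ennreal (2^k * (cmod (d k x))\<^sup>2) \<le> ennreal C"
        by (simp only: C(1)) simp
      then have "2^k * (cmod (d k x))\<^sup>2 \<le> C" using C(2) by simp
      then have "(cmod (d k x))\<^sup>2 \<le> C / 2^k" by (simp add: field_simps)
      then have "cmod (d k x) \<le> sqrt (C / 2^k)" by (rule real_le_rsqrt)
      also have "sqrt (C / 2^k) = sqrt C * (1 / sqrt 2)^k"
        by (simp only: real_sqrt_divide real_sqrt_power power_divide power_one) simp
      finally show ?thesis .
    qed
    moreover have "summable (\<lambda>k. sqrt C * (1 / sqrt 2)^k)"
      by (intro summable_mult summable_geometric) auto
    ultimately have "summable (\<lambda>k. d k x)"
      by (blast intro: summable_comparison_test'[where N=0])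
    then have "convergent (\<lambda>n. \<Sum>k<n. d k x)" by (simp only: summable_iff_convergent)
    moreover have "(\<Sum>k<n. d k x) = u (r n) x - u (r 0) x" for n
      unfolding d_def by (rule sum_lessThan_telescope)
    ultimately have "convergent (\<lambda>n. u (r n) x - u (r 0) x)" by (simp only:)
    then have "convergent (\<lambda>n. (u (r n) x - u (r 0) x) + u (r 0) x)"
      by (intro convergent_add convergent_const)
    then show ?case by simp
  qed
  define g where "g x = lim (\<lambda>k. u (r k) x)" for x
  have [measurable]: "g \<in> borel_measurable M"
    unfolding g_def by measurable
  \<comment> \<open>The index \<open>n\<close> stays fixed while the other one runs along the
    subsequence, so the Cauchy bound survives in the limit for the whole sequence.\<close>
  have Fatou: "(\<integral>\<^sup>+x. ennreal ((cmod (u n x - g x))\<^sup>2) \<partial>M) \<le> ennreal e"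
    if e: "e > 0" and n: "\<forall>m\<ge>K. \<forall>n\<ge>K. sqnorm M (\<lambda>x. u m x - u n x) < e" "n \<ge> K" for e n K
  proof -
    have "(\<integral>\<^sup>+x. ennreal ((cmod (u n x - g x))\<^sup>2) \<partial>M)
        = (\<integral>\<^sup>+x. liminf (\<lambda>k. ennreal ((cmod (u n x - u (r k) x))\<^sup>2)) \<partial>M)"
      using conv
    proof (intro nn_integral_cong_AE, eventually_elim)
      case (elim x)
      then have "(\<lambda>k. u (r k) x) \<longlonglongrightarrow> g x" by (simp add: g_def convergent_LIMSEQ_iff)
      then have "(\<lambda>k. ennreal ((cmod (u n x - u (r k) x))\<^sup>2)) \<longlonglongrightarrow> ennreal ((cmod (u n x - g x))\<^sup>2)"
        by (intro tendsto_intros tendsto_ennrealI)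
      then show ?case by (rule lim_imp_Liminf[OF trivial_limit_sequentially, symmetric])
    qed
    also have "\<dots> \<le> liminf (\<lambda>k. \<integral>\<^sup>+x. ennreal ((cmod (u n x - u (r k) x))\<^sup>2) \<partial>M)"
      by (rule nn_integral_liminf) measurable
    also have "\<dots> = liminf (\<lambda>k. ennreal (sqnorm M (\<lambda>x. u n x - u (r k) x)))"
      by (simp only: nn_integral_sqnorm[OF square_integrable_diff[OF u u]])
    also have "\<dots> \<le> liminf (\<lambda>k. ennreal e)"
    proof (rule Liminf_mono)
      show "\<forall>\<^sub>F k in sequentially. ennreal (sqnorm M (\<lambda>x. u n x - u (r k) x)) \<le> ennreal e"
        using eventually_ge_at_top[of K]
      proof eventually_elim
        case (elim k)
        then have "r k \<ge> K" using r_ge[of k] by linarith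
        then show ?case using n by (intro ennreal_leI less_imp_le) auto
      qed
    qed
    also have "\<dots> = ennreal e" by (simp add: Liminf_const)
    finally show ?thesis .
  qed
  have diff: "square_integrable M (\<lambda>x. u n x - g x)"
    if "\<forall>m\<ge>K. \<forall>n\<ge>K. sqnorm M (\<lambda>x. u m x - u n x) < 1" "n \<ge> K" for n K
    using Fatou[OF _ that] by (intro square_integrableI_nn) (auto intro: le_less_trans)
  obtain K1 where K1: "\<forall>m\<ge>K1. \<forall>n\<ge>K1. sqnorm M (\<lambda>x. u m x - u n x) < 1"
    using Cauchy[of 1] by auto
  have g: "square_integrable M g"
    using square_integrable_diff[OF u[of K1] diff[OF K1, of K1]] by simp
  moreover have "(\<lambda>n. sqnorm M (\<lambda>x. u n x - g x)) \<longlonglongrightarrow> 0"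
  proof (rule LIMSEQ_I)
    fix e :: real assume e: "e > 0"
    obtain K where K: "\<forall>m\<ge>K. \<forall>n\<ge>K. sqnorm M (\<lambda>x. u m x - u n x) < e / 2"
      using Cauchy[of "e / 2"] e by auto
    have "norm (sqnorm M (\<lambda>x. u n x - g x) - 0) < e" if "n \<ge> K" for n
    proof -
      have "ennreal (sqnorm M (\<lambda>x. u n x - g x)) \<le> ennreal (e / 2)"
        using Fatou[OF _ K that] e u g by (simp flip: nn_integral_sqnorm)
      then have "sqnorm M (\<lambda>x. u n x - g x) \<le> e / 2" using e by simp
      then show ?thesis using e by simp
    qed
    then show "\<exists>no. \<forall>n\<ge>no. norm (sqnorm M (\<lambda>x. u n x - g x) - 0) < e" by blast
  qed
  ultimately show ?thesis by blast
qed

section \<open>Fourier series on an interval\<close>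

text \<open>Translates between \<open>ennreal\<close> integrals, where sums and integrals
  interchange freely, and the unordered sums of the final result.\<close>

lemma nn_integral_count_space_iff_has_sum:
  fixes f :: "'a \<Rightarrow> real"
  assumes f: "\<And>x. 0 \<le> f x" and s: "0 \<le> s"
  shows "(\<integral>\<^sup>+x. ennreal (f x) \<partial>count_space A) = ennreal s \<longleftrightarrow> (f has_sum s) A"
proof
  assume eq: "(\<integral>\<^sup>+x. ennreal (f x) \<partial>count_space A) = ennreal s"
  have "has_bochner_integral (count_space A) f s"
    by (rule has_bochner_integral_nn_integral) (use eq f s in auto)
  then have I: "integrable (count_space A) f" "integral\<^sup>L (count_space A) f = s"
    by (auto simp: has_bochner_integral_iff)
  from I(1) have abs: "Infinite_Set_Sum.abs_summable_on f A"
    by (simp add: abs_summable_on_def)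
  have "f summable_on A"
    using abs[unfolded abs_summable_equivalent[symmetric]] by (rule abs_summable_summable)
  moreover have "infsum f A = s"
    using infsetsum_infsum[OF abs] I(2) by (simp add: infsetsum_def)
  ultimately show "(f has_sum s) A" using has_sum_infsum by metis
next
  assume hs: "(f has_sum s) A"
  then have "f summable_on A" by (rule has_sum_imp_summable)
  then have abs: "Infinite_Set_Sum.abs_summable_on f A"
    using f by (subst abs_summable_equivalent[symmetric]) simp
  then have I: "integrable (count_space A) f" by (simp add: abs_summable_on_def)
  have "(\<integral>\<^sup>+x. ennreal (f x) \<partial>count_space A) = ennreal (integral\<^sup>L (count_space A) f)"
    by (rule nn_integral_eq_integral[OF I]) (use f in auto)
  also have "integral\<^sup>L (count_space A) f = infsum f A"
    using infsetsum_infsum[OF abs] by (simp add: infsetsum_def)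
  also have "infsum f A = s" using hs by (rule infsumI)
  finally show "(\<integral>\<^sup>+x. ennreal (f x) \<partial>count_space A) = ennreal s" .
qed

lemma inner_L2_sum_right:
  assumes "square_integrable M f" "\<And>i. i \<in> I \<Longrightarrow> square_integrable M (g i)"
  shows "inner_L2 M f (\<lambda>x. \<Sum>i\<in>I. g i x) = (\<Sum>i\<in>I. inner_L2 M f (g i))"
  unfolding inner_L2_def sum_distrib_left
  by (rule Bochner_Integration.integral_sum) (use assms integrable_inner_L2 in blast)

lemma inner_L2_sum_left:
  assumes "square_integrable M f" "\<And>i. i \<in> I \<Longrightarrow> square_integrable M (g i)"
  shows "inner_L2 M (\<lambda>x. \<Sum>i\<in>I. g i x) f = (\<Sum>i\<in>I. inner_L2 M (g i) f)"
proof -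
  have "inner_L2 M (\<lambda>x. \<Sum>i\<in>I. g i x) f = cnj (\<Sum>i\<in>I. inner_L2 M f (g i))"
    by (subst inner_L2_commute) (simp only: inner_L2_sum_right[OF assms])
  then show ?thesis by (simp flip: inner_L2_commute)
qed

text \<open>Completing the square in the coefficients. Taking \<open>c\<close> to be the Fourier
  coefficients gives Bessel's inequality; an arbitrary \<open>c\<close> shows that no other
  combination comes closer to \<open>g\<close>.\<close>

lemma sqnorm_orthonormal_expansion:
  assumes g: "square_integrable M g" and e: "\<And>i. square_integrable M (e i)"
    and orth: "\<And>i j. inner_L2 M (e i) (e j) = of_bool (i = j)" and S: "finite S"
  shows "sqnorm M (\<lambda>x. g x - (\<Sum>i\<in>S. c i * e i x)) = sqnorm M g
    - (\<Sum>i\<in>S. (cmod (inner_L2 M (e i) g))\<^sup>2) + (\<Sum>i\<in>S. (cmod (inner_L2 M (e i) g - c i))\<^sup>2)"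
proof -
  let ?p = "\<lambda>x. \<Sum>i\<in>S. c i * e i x"
  have "inner_L2 M ?p ?p = (\<Sum>i\<in>S. (\<Sum>j\<in>S. cnj (c i) * (c j * of_bool (i = j))))"
    using e by (simp add: inner_L2_sum_left inner_L2_sum_right orth sum_distrib_left)
  also have "\<dots> = (\<Sum>i\<in>S. complex_of_real ((cmod (c i))\<^sup>2))"
    using S by (intro sum.cong refl)
      (simp add: of_bool_def if_distrib sum.delta complex_norm_square mult.commute
        del: of_real_power cong: if_cong)
  finally have p: "sqnorm M ?p = (\<Sum>i\<in>S. (cmod (c i))\<^sup>2)"
    unfolding inner_L2_self by (simp only: of_real_eq_iff flip: of_real_sum)
  have gp: "inner_L2 M ?p g = (\<Sum>i\<in>S. cnj (c i) * inner_L2 M (e i) g)"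
    using e g by (simp add: inner_L2_sum_left)
  have "(cmod (inner_L2 M (e i) g - c i))\<^sup>2 = (cmod (inner_L2 M (e i) g))\<^sup>2 + (cmod (c i))\<^sup>2
    - 2 * Re (cnj (c i) * inner_L2 M (e i) g)" for i
    unfolding cmod_power2 by (simp add: power2_eq_square algebra_simps)
  then show ?thesis
    using e g by (subst sqnorm_minus_commute, subst sqnorm_diff)
      (auto simp: p gp sum.distrib sum_subtractf sum_distrib_left)
qed

text \<open>Bessel's inequality bounds the finite sums above. By the same expansion, a good
  approximation supported on \<open>S\<close> makes the sum over \<open>S\<close> nearly the full
  squared norm.\<close>

lemma Parseval_orthonormal:
  assumes g: "square_integrable M g" and e: "\<And>i. square_integrable M (e i)"
    and orth: "\<And>i j. inner_L2 M (e i) (e j) = of_bool (i = j)"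
    and dense: "\<And>\<epsilon>. \<epsilon> > 0 \<Longrightarrow>
      \<exists>S c. finite S \<and> sqnorm M (\<lambda>x. g x - (\<Sum>i\<in>S. c i * e i x)) < \<epsilon>"
  shows "((\<lambda>i. (cmod (inner_L2 M (e i) g))\<^sup>2) has_sum sqnorm M g) UNIV"
proof -
  let ?a = "\<lambda>i. (cmod (inner_L2 M (e i) g))\<^sup>2"
  note exp = sqnorm_orthonormal_expansion[OF g e orth]
  have Bessel: "sum ?a S \<le> sqnorm M g" if "finite S" for S
    using exp[OF that, of "\<lambda>i. inner_L2 M (e i) g"]
      sqnorm_nonneg[of M "\<lambda>x. g x - (\<Sum>i\<in>S. inner_L2 M (e i) g * e i x)"] by simp
  have ge: "\<exists>S. finite S \<and> sqnorm M g - \<epsilon> < sum ?a S" if "\<epsilon> > 0" for \<epsilon>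
  proof -
    from dense[OF that] obtain S c where S: "finite S"
      and lt: "sqnorm M (\<lambda>x. g x - (\<Sum>i\<in>S. c i * e i x)) < \<epsilon>" by blast
    have "0 \<le> (\<Sum>i\<in>S. (cmod (inner_L2 M (e i) g - c i))\<^sup>2)" by (intro sum_nonneg) simp
    then show ?thesis using exp[OF S, of c] lt S by (intro exI[of _ S]) linarith
  qed
  show ?thesis
    unfolding has_sum_def
  proof (rule order_tendstoI)
    fix y assume "y < sqnorm M g"
    then obtain S where S: "finite S" "y < sum ?a S" using ge[of "sqnorm M g - y"] by auto
    have "y < sum ?a T" if "finite T" "S \<subseteq> T" for T
      using S(2) sum_mono2[OF that, of ?a] by (auto intro: less_le_trans)
    then show "\<forall>\<^sub>F T in finite_subsets_at_top UNIV. y < sum ?a T"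
      unfolding eventually_finite_subsets_at_top using S(1) by (intro exI[of _ S]) auto
  next
    fix y assume y: "sqnorm M g < y"
    show "\<forall>\<^sub>F T in finite_subsets_at_top UNIV. sum ?a T < y"
      using eventually_finite_subsets_at_top_weakI[of UNIV "\<lambda>T. sum ?a T < y"]
        Bessel y by (meson le_less_trans)
  qed
qed

section \<open>Exponentials on the unit interval: orthonormality and density of their span\<close>

abbreviation M01 :: "real measure" where
  "M01 \<equiv> restrict_space lborel {0..1}"

definition chr :: "int \<Rightarrow> real \<Rightarrow> complex" where
  "chr m x = cis (2 * pi * of_int m * x)"

lemma cmod_chr [simp]: "cmod (chr m x) = 1"
  by (simp add: chr_def)

lemma chr_mult: "chr m x * chr k x = chr (m + k) x"
  by (simp add: chr_def cis_mult algebra_simps)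

lemma borel_measurable_cis [measurable]:
  "f \<in> borel_measurable M \<Longrightarrow> (\<lambda>x. cis (f x)) \<in> borel_measurable M"
  by (rule measurable_compose[OF _ borel_measurable_continuous_onI]) (auto intro!: continuous_intros)

lemma chr_measurable [measurable]: "chr m \<in> borel_measurable M01"
  unfolding chr_def by (rule measurable_restrict_space1) measurable

lemma space_M01 [simp]: "space M01 = {0..1}"
  by (simp add: space_restrict_space)

lemma finite_measure_M01: "finite_measure M01"
  by (rule finite_measureI) (simp add: emeasure_restrict_space)

lemma integrable_M01_iff:
  fixes f :: "real \<Rightarrow> 'b::{banach, second_countable_topology}"
  shows "integrable M01 f \<longleftrightarrow> integrable lborel (\<lambda>x. indicator {0..1} x *\<^sub>R f x)"
  by (rule integrable_restrict_space) simp

lemma integral_M01: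
  fixes f :: "real \<Rightarrow> 'b::{banach, second_countable_topology}"
  shows "integral\<^sup>L M01 f = (LINT x|lborel. indicator {0..1} x *\<^sub>R f x)"
  by (rule integral_restrict_space) simp

lemma square_integrable_chr [simp]: "square_integrable M01 (chr m)"
  unfolding square_integrable_def using finite_measure.integrable_const[OF finite_measure_M01]
  by simp

lemma inner_chr: "inner_L2 M01 (chr m) (chr k) = of_bool (m = k)"
proof -
  have "inner_L2 M01 (chr m) (chr k) = (LINT x|lborel. indicator {0..1} x *\<^sub>R chr (k - m) x)"
    unfolding inner_L2_def integral_M01
    by (intro Bochner_Integration.integral_cong refl) (simp add: chr_def cis_cnj cis_mult algebra_simps)
  also have "\<dots> = of_bool (m = k)"
  proof (cases "m = k")
    case True
    then show ?thesis by (simp add: chr_def)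
  next
    case False
    define w where "w = 2 * pi * of_int (k - m)"
    have w: "w \<noteq> 0" using False by (simp add: w_def)
    have der: "((\<lambda>x. - \<i> / w * cis (w * x)) has_vector_derivative cis (w * x)) (at x within {0..1})" for x
    proof -
      have "((\<lambda>z. - \<i> / w * exp (\<i> * (w * z))) has_field_derivative exp (\<i> * (w * of_real x)))
          (at (of_real x))"
        using w by (auto intro!: derivative_eq_intros)
      from has_vector_derivative_real_field[OF this] show ?thesis by (simp add: cis_conv_exp)
    qed
    have "(LINT x|lborel. indicator {0..1} x *\<^sub>R cis (w * x)) = - \<i> / w * cis (w * 1) - - \<i> / w * cis (w * 0)"
      by (rule integral_FTC_Icc[OF _ der]) (auto intro!: continuous_intros)
    \<comment> \<open>\<open>w\<close> is an integer multiple of 2 pi, so the primitive takes equal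
      values at both endpoints.\<close>
    also have "cis (w * 1) = 1" unfolding w_def using cis_multiple_2pi[of "of_int (k - m)"] by simp
    finally show ?thesis using False by (simp add: chr_def w_def)
  qed
  finally show ?thesis .
qed

text \<open>The inductive form reduces closure under sums and products to adding one term at a time;
  \<open>trig_poly_sum_rep\<close> recovers finite sums with distinct frequencies.\<close>

inductive trig_poly :: "(real \<Rightarrow> complex) \<Rightarrow> bool" where
  zero: "trig_poly (\<lambda>x. 0)"
| add_term: "trig_poly p \<Longrightarrow> trig_poly (\<lambda>x. p x + c * chr m x)"

lemma trig_poly_add: "trig_poly q \<Longrightarrow> trig_poly p \<Longrightarrow> trig_poly (\<lambda>x. p x + q x)"
proof (induction rule: trig_poly.induct)
  case (add_term q c m)
  then show ?case
    using trig_poly.add_term[of "\<lambda>x. p x + q x" c m] by (simp add: add.assoc)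
qed simp

lemma trig_poly_term: "trig_poly (\<lambda>x. c * chr m x)"
  using trig_poly.add_term[OF trig_poly.zero, of c m] by simp

lemma trig_poly_const: "trig_poly (\<lambda>x. c)"
  using trig_poly_term[of c 0] by (simp add: chr_def)

lemma trig_poly_mult_term: "trig_poly p \<Longrightarrow> trig_poly (\<lambda>x. p x * (c * chr m x))"
proof (induction rule: trig_poly.induct)
  case (add_term p d k)
  have "(\<lambda>x. (p x + d * chr k x) * (c * chr m x)) = (\<lambda>x. p x * (c * chr m x) + (d * c) * chr (k + m) x)"
    by (simp add: chr_mult[symmetric] algebra_simps)
  then show ?case using trig_poly.add_term[OF add_term.IH] by simp
qed (simp add: trig_poly.zero)

lemma trig_poly_mult: "trig_poly q \<Longrightarrow> trig_poly p \<Longrightarrow> trig_poly (\<lambda>x. p x * q x)"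
proof (induction rule: trig_poly.induct)
  case (add_term q c m)
  then show ?case
    using trig_poly_add[OF trig_poly_mult_term[of p c m], of "\<lambda>x. p x * q x"]
    by (simp add: distrib_left)
qed (simp add: trig_poly.zero)

lemma trig_poly_sum_rep: "trig_poly p \<Longrightarrow> \<exists>S c. finite S \<and> p = (\<lambda>x. \<Sum>m\<in>S. c m * chr m x)"
proof (induction rule: trig_poly.induct)
  case zero
  show ?case by (intro exI[of _ "{}"]) auto
next
  case (add_term p d k)
  then obtain S c where S: "finite S" "p = (\<lambda>x. \<Sum>m\<in>S. c m * chr m x)" by blast
  \<comment> \<open>The frequency \<open>k\<close> may already occur in \<open>S\<close>, so its
    coefficients have to be added.\<close>
  define c' where "c' m = (if m \<in> S then c m else 0) + (if m = k then d else 0)" for m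
  have "(\<Sum>m\<in>insert k S. c' m * chr m x) = p x + d * chr k x" for x
  proof -
    have "(\<Sum>m\<in>insert k S. c' m * chr m x) = (\<Sum>m\<in>insert k S. (if m \<in> S then c m * chr m x else 0))
       + (\<Sum>m\<in>insert k S. if m = k then d * chr m x else 0)"
      unfolding sum.distrib[symmetric] c'_def by (intro sum.cong) (auto simp: distrib_right)
    also have "(\<Sum>m\<in>insert k S. (if m \<in> S then c m * chr m x else 0)) = (\<Sum>m\<in>S. c m * chr m x)"
      using S(1) by (intro sum.mono_neutral_cong_right) auto
    finally show ?thesis using S by simp
  qed
  then show ?case using S(1) by (intro exI[of _ "insert k S"] exI[of _ c']) auto
qed

lemma trig_poly_square_integrable: "trig_poly p \<Longrightarrow> square_integrable M01 p"
  by (induction rule: trig_poly.induct) auto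

text \<open>Stone--Weierstrass delivers real polynomials on the circle. Real-linear functions there
  are combinations of cosine and sine, and products of exponentials are exponentials.\<close>

lemma trig_poly_real_polynomial_function:
  "real_polynomial_function g \<Longrightarrow> trig_poly (\<lambda>x. of_real (g (cis (2 * pi * x))))"
proof (induction rule: real_polynomial_function.induct)
  case (linear g)
  interpret bounded_linear g by fact
  have g: "g (cis t) = cos t * g 1 + sin t * g \<i>" for t
  proof -
    have "cis t = cos t *\<^sub>R 1 + sin t *\<^sub>R \<i>" by (simp add: complex_eq_iff)
    then show ?thesis by (simp add: add scale)
  qed
  \<comment> \<open>Euler's formulas: a cos t + b sin t has coefficients (a - i b) / 2 and (a + i b)
    / 2 at frequencies 1 and -1.\<close>
  have "(\<lambda>x. complex_of_real (g (cis (2 * pi * x)))) =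
    (\<lambda>x. (g 1 - \<i> * g \<i>) / 2 * chr 1 x + (g 1 + \<i> * g \<i>) / 2 * chr (-1) x)"
    unfolding g chr_def by (auto simp: complex_eq_iff field_simps)
  then show ?case by (simp only: trig_poly_add trig_poly_term)
next
  case (const c)
  show ?case by (rule trig_poly_const)
next
  case (add f g)
  then show ?case using trig_poly_add by simp
next
  case (mult f g)
  then show ?case using trig_poly_mult by simp
qed

definition approximable :: "(real \<Rightarrow> complex) \<Rightarrow> bool" where
  "approximable g \<longleftrightarrow> square_integrable M01 g \<and>
     (\<forall>\<epsilon>>0. \<exists>p. trig_poly p \<and> sqnorm M01 (\<lambda>x. g x - p x) < \<epsilon>)"

lemma approximable_add:
  assumes "approximable f" "approximable g"
  shows "approximable (\<lambda>x. f x + g x)"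
  unfolding approximable_def
proof (intro conjI allI impI)
  show "square_integrable M01 (\<lambda>x. f x + g x)"
    using assms by (auto simp: approximable_def)
  fix \<epsilon> :: real assume "\<epsilon> > 0"
  then have "\<epsilon> / 4 > 0" by simp
  with assms obtain p q where p: "trig_poly p" "sqnorm M01 (\<lambda>x. f x - p x) < \<epsilon> / 4"
    and q: "trig_poly q" "sqnorm M01 (\<lambda>x. g x - q x) < \<epsilon> / 4"
    unfolding approximable_def by meson
  have "sqnorm M01 (\<lambda>x. (f x - p x) + (g x - q x)) < \<epsilon>"
    using sqnorm_add_le[of M01 "\<lambda>x. f x - p x" "\<lambda>x. g x - q x"] p q assms
      trig_poly_square_integrable by (fastforce simp: approximable_def)
  then have "sqnorm M01 (\<lambda>x. f x + g x - (p x + q x)) < \<epsilon>"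
    by (simp add: algebra_simps)
  then show "\<exists>p. trig_poly p \<and> sqnorm M01 (\<lambda>x. f x + g x - p x) < \<epsilon>"
    using trig_poly_add[OF q(1) p(1)] by blast
qed

lemma approximable_cmult:
  assumes "approximable g"
  shows "approximable (\<lambda>x. c * g x)"
proof (cases "c = 0")
  case True
  have "sqnorm M01 (\<lambda>x. 0) = 0" by (simp add: sqnorm_def)
  then show ?thesis using True trig_poly.zero by (auto simp: approximable_def intro!: exI[of _ "\<lambda>x. 0"])
next
  case False
  show ?thesis
    unfolding approximable_def
  proof (intro conjI allI impI)
    show "square_integrable M01 (\<lambda>x. c * g x)"
      using assms by (auto simp: approximable_def)
    fix \<epsilon> :: real assume "\<epsilon> > 0"
    then have "\<epsilon> / (cmod c)\<^sup>2 > 0" using False by simp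
    with assms obtain p where p: "trig_poly p" "sqnorm M01 (\<lambda>x. g x - p x) < \<epsilon> / (cmod c)\<^sup>2"
      unfolding approximable_def by meson
    have "sqnorm M01 (\<lambda>x. c * (g x - p x)) < \<epsilon>"
      using p(2) False by (simp only: sqnorm_cmult) (simp add: field_simps)
    then have "sqnorm M01 (\<lambda>x. c * g x - c * p x) < \<epsilon>" by (simp only: right_diff_distrib)
    then show "\<exists>p. trig_poly p \<and> sqnorm M01 (\<lambda>x. c * g x - p x) < \<epsilon>"
      using trig_poly_mult[OF p(1) trig_poly_const[of c]] by blast
  qed
qed

lemma approximable_sum:
  "(\<And>i. i \<in> I \<Longrightarrow> approximable (g i)) \<Longrightarrow> approximable (\<lambda>x. \<Sum>i\<in>I. g i x)"
proof (induction I rule: infinite_finite_induct)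
  case (insert i I)
  then show ?case using approximable_add by simp
qed (use approximable_cmult[of _ 0] in \<open>auto simp: approximable_def sqnorm_def intro: trig_poly.zero exI[of _ "\<lambda>x. 0"]\<close>)

lemma approximable_limit:
  assumes g: "square_integrable M01 g" and s: "\<And>i. approximable (s i)"
    and lim: "(\<lambda>i. sqnorm M01 (\<lambda>x. s i x - g x)) \<longlonglongrightarrow> 0"
  shows "approximable g"
  unfolding approximable_def
proof (intro conjI allI impI g)
  fix \<epsilon> :: real assume \<epsilon>: "\<epsilon> > 0"
  from order_tendstoD(2)[OF lim, of "\<epsilon> / 4"] \<epsilon> obtain i where i: "sqnorm M01 (\<lambda>x. s i x - g x) < \<epsilon> / 4"
    by (auto simp: eventually_sequentially)
  obtain p where p: "trig_poly p" "sqnorm M01 (\<lambda>x. s i x - p x) < \<epsilon> / 4"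
    using s[of i] \<epsilon> unfolding approximable_def by (meson divide_pos_pos zero_less_numeral)
  have "sqnorm M01 (\<lambda>x. g x - p x) < \<epsilon>"
    using sqnorm_triangle[of M01 g "s i" p] p i s[of i] g trig_poly_square_integrable[OF p(1)]
      sqnorm_minus_commute[of M01 g "s i"] by (simp add: approximable_def)
  with p(1) show "\<exists>p. trig_poly p \<and> sqnorm M01 (\<lambda>x. g x - p x) < \<epsilon>" by blast
qed


text \<open>The endpoints 0 and 1 have the same image on the circle; an interior point shares its
  image with no other point of the closed interval.\<close>

lemma cis_2pi_eqD:
  assumes "cis (2 * pi * x) = cis (2 * pi * y)" "x \<in> {0<..<1}" "y \<in> {0..1}"
  shows "x = y"
proof -
  from assms(1) have "sin (2 * pi * x) = sin (2 * pi * y) \<and> cos (2 * pi * x) = cos (2 * pi * y)"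
    by (simp add: complex_eq_iff)
  then obtain n :: int where "2 * pi * x = 2 * pi * y + 2 * pi * n"
    by (subst (asm) sin_cos_eq_iff) auto
  then have "2 * pi * (x - y - n) = 0" by (simp add: algebra_simps)
  then have n: "x - y = of_int n" by simp
  then have "\<bar>of_int n\<bar> < (1::real)" using assms(2,3) by auto
  then have "n = 0" by linarith
  then show ?thesis using n by simp
qed

text \<open>Between a compact set and an open neighbourhood of it, both inside \<open>(0, 1)\<close>, Urysohn's lemma on
  the unit circle and the Stone--Weierstrass theorem give a trigonometric polynomial that is
  uniformly close to the indicator function, except on the difference of the two sets.\<close>

lemma approximable_indicator:
  assumes A: "A \<in> sets borel"
  shows "approximable (indicator A)"
  unfolding approximable_def
proof (intro conjI allI impI)
  have [measurable]: "A \<in> sets borel" by fact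
  have meas: "(indicator A :: real \<Rightarrow> complex) \<in> borel_measurable M01"
    by (rule measurable_restrict_space1) measurable
  show sq: "square_integrable M01 (indicator A)"
    by (rule square_integrable_bound[OF square_integrable_chr[of 0] meas, where C=1])
      (auto simp: indicator_def)
  fix \<epsilon> :: real assume \<epsilon>: "\<epsilon> > 0"
  \<comment> \<open>The final error is 6 \<delta>: 2 \<delta> from the uniform approximation and
    twice the measure of \<open>U - K\<close>, which is at most 2 \<delta>. The bound by 1 gives
    \<open>\<delta>\<^sup>2 \<le> \<delta>\<close>.\<close>
  define \<delta> where "\<delta> = min 1 (\<epsilon> / 8)"
  have \<delta>: "\<delta> > 0" "\<delta> \<le> \<epsilon> / 8" "\<delta> \<le> 1" using \<epsilon> by (auto simp: \<delta>_def)
  \<comment> \<open>Removing the glued endpoints costs a null set and keeps the images of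
    \<open>K\<close> and of the complement of \<open>U\<close> disjoint on the circle.\<close>
  define A' where "A' = A \<inter> {0<..<1}"
  have [measurable]: "A' \<in> sets borel" by (simp add: A'_def)
  then have A'_leb: "A' \<in> sets lebesgue" by simp
  obtain K where K: "closed K" "K \<subseteq> A'" "A' - K \<in> lmeasurable" "emeasure lebesgue (A' - K) < ennreal \<delta>"
    by (rule sets_lebesgue_inner_closed[OF A'_leb \<delta>(1)])
  obtain V where V: "open V" "A' \<subseteq> V" "V - A' \<in> lmeasurable" "emeasure lebesgue (V - A') < ennreal \<delta>"
    by (rule sets_lebesgue_outer_open[OF A'_leb \<delta>(1)])
  define U where "U = V \<inter> {0<..<1}"
  have U: "open U" "A' \<subseteq> U" using V by (auto simp: U_def A'_def)
  have [measurable]: "K \<in> sets borel" "U \<in> sets borel" "V \<in> sets borel"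
    using K(1) U(1) V(1) by auto
  have "emeasure lborel (U - K) \<le> emeasure lborel ((V - A') \<union> (A' - K))"
    by (intro emeasure_mono) (auto simp: U_def)
  also have "\<dots> \<le> emeasure lborel (V - A') + emeasure lborel (A' - K)"
    by (intro emeasure_subadditive) auto
  also have "\<dots> \<le> ennreal \<delta> + ennreal \<delta>"
    using K(4) V(4) by (intro add_mono) auto
  also have "\<dots> = ennreal (2 * \<delta>)" using \<delta>(1) by (simp flip: ennreal_plus)
  finally have UK: "emeasure lborel (U - K) \<le> ennreal (2 * \<delta>)" .
  define E where "E x = cis (2 * pi * x)" for x :: real
  have contE: "continuous_on S E" for S
    unfolding E_def by (intro continuous_intros)
  have "bounded K" by (rule bounded_subset[of "{0..1}"]) (use K A'_def in auto)
  then have "compact K" using K(1) by (simp add: compact_eq_bounded_closed)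
  then have cK: "compact (E ` K)" by (intro compact_continuous_image contE)
  have "compact ({0..1} \<inter> - U)" by (intro compact_Int_closed closed_Compl U) auto
  then have cC: "compact (E ` ({0..1} \<inter> - U))" by (intro compact_continuous_image contE)
  have disj: "E ` K \<inter> E ` ({0..1} \<inter> - U) = {}"
  proof -
    have False if "x \<in> K" "y \<in> {0..1} \<inter> - U" "E x = E y" for x y
    proof -
      have "x \<in> {0<..<1}" "x \<in> U" using that(1) K(2) U(2) by (auto simp: A'_def)
      moreover have "x = y"
        using cis_2pi_eqD[OF that(3)[unfolded E_def] \<open>x \<in> {0<..<1}\<close>] that(2) by blast
      ultimately show False using that(2) by blast
    qed
    then show ?thesis by fastforce
  qed
  have "\<exists>\<phi> :: complex \<Rightarrow> real. continuous_on UNIV \<phi> \<and> (\<forall>z. \<phi> z \<in> closed_segment 1 0) \<and>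
      (\<forall>z\<in>E ` K. \<phi> z = 1) \<and> (\<forall>z\<in>E ` ({0..1} \<inter> - U). \<phi> z = 0)"
  proof (rule Urysohn[OF compact_imp_closed[OF cK] compact_imp_closed[OF cC] disj, where a=1 and b="0::real"])
    fix f :: "complex \<Rightarrow> real"
    assume f: "continuous_on UNIV f" "\<And>z. f z \<in> closed_segment 1 0"
      "\<And>z. z \<in> E ` K \<Longrightarrow> f z = 1" "\<And>z. z \<in> E ` ({0..1} \<inter> - U) \<Longrightarrow> f z = 0"
    show ?thesis by (intro exI[of _ f] conjI allI ballI f)
  qed
  then obtain \<phi> :: "complex \<Rightarrow> real" where \<phi>: "continuous_on UNIV \<phi>"
    "\<forall>z. \<phi> z \<in> closed_segment 1 0" "\<forall>z\<in>E ` K. \<phi> z = 1" "\<forall>z\<in>E ` ({0..1} \<inter> - U). \<phi> z = 0"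
    by (elim exE conjE)
  obtain q where q: "real_polynomial_function q" "\<And>z. z \<in> sphere 0 1 \<Longrightarrow> \<bar>\<phi> z - q z\<bar> < \<delta>"
    using Stone_Weierstrass_real_polynomial_function[of "sphere 0 1" \<phi> \<delta>]
      continuous_on_subset[OF \<phi>(1) subset_UNIV] \<delta>(1) compact_sphere by blast
  define P where "P x = complex_of_real (q (E x))" for x
  have P: "trig_poly P"
    using trig_poly_real_polynomial_function[OF q(1)] unfolding P_def E_def .
  note sqP = trig_poly_square_integrable[OF P]
  have bound: "(cmod (indicator A x - P x))\<^sup>2 \<le> 2 * \<delta> + 2 * indicator (U - K) x"
    if x: "x \<in> {0..1}" "x \<noteq> 0" "x \<noteq> 1" for x
  proof -
    have "E x \<in> sphere 0 1" by (simp add: E_def)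
    from q(2)[OF this] have 1: "\<bar>\<phi> (E x) - q (E x)\<bar> < \<delta>" .
    \<comment> \<open>On \<open>K\<close> both functions are 1 and off \<open>U\<close> both are 0;
      in between both lie in [0, 1].\<close>
    have 2: "\<bar>indicator A x - \<phi> (E x)\<bar> \<le> indicator (U - K) x"
    proof (cases "x \<in> U - K")
      case True
      then show ?thesis using spec[OF \<phi>(2), of "E x"]
        by (auto simp: closed_segment_eq_real_ivl indicator_def)
    next
      case False
      then consider "x \<in> K" | "x \<notin> U" by blast
      then show ?thesis
      proof cases
        case 1
        then have "\<phi> (E x) = 1" "x \<in> A" using \<phi>(3) K(2) by (simp, auto simp: A'_def)
        then show ?thesis by simp
      next
        case 2
        then have "x \<notin> A" using U(2) x by (auto simp: A'_def)
        moreover have "\<phi> (E x) = 0" using \<phi>(4) 2 x(1) by blast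
        ultimately show ?thesis by simp
      qed
    qed
    have "indicator A x - P x = of_real (indicator A x - q (E x))"
      by (simp add: P_def indicator_def)
    then have "cmod (indicator A x - P x) = \<bar>indicator A x - q (E x)\<bar>"
      by (simp only: norm_of_real)
    also have "\<dots> \<le> indicator (U - K) x + \<delta>" using 1 2 by linarith
    finally have "(cmod (indicator A x - P x))\<^sup>2 \<le> (indicator (U - K) x + \<delta>)\<^sup>2"
      by (intro power_mono) auto
    also have "\<dots> \<le> 2 * (indicator (U - K) x)\<^sup>2 + 2 * \<delta>\<^sup>2"
      using sum_squares_bound[of "indicator (U - K) x" \<delta>] by (simp add: power2_sum)
    also have "(indicator (U - K) x)\<^sup>2 = (indicator (U - K) x :: real)" by (auto simp: indicator_def)
    also have "\<delta>\<^sup>2 \<le> \<delta>" using \<delta> by (simp add: power2_eq_square mult_left_le)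
    finally show ?thesis by simp
  qed
  have "ennreal (sqnorm M01 (\<lambda>x. indicator A x - P x)) = (\<integral>\<^sup>+x. ennreal ((cmod (indicator A x - P x))\<^sup>2) \<partial>M01)"
    using sq sqP by (simp add: nn_integral_sqnorm)
  also have "\<dots> = (\<integral>\<^sup>+x. ennreal ((cmod (indicator A x - P x))\<^sup>2) * indicator {0..1} x \<partial>lborel)"
    by (rule nn_integral_restrict_space) simp
  also have "\<dots> \<le> (\<integral>\<^sup>+x. ennreal (2 * \<delta>) * indicator {0..1} x + 2 * indicator (U - K) x \<partial>lborel)"
  proof (rule nn_integral_mono_AE)
    show "AE x in lborel. ennreal ((cmod (indicator A x - P x))\<^sup>2) * indicator {0..1} x
        \<le> ennreal (2 * \<delta>) * indicator {0..1} x + 2 * indicator (U - K) x"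
      using AE_lborel_singleton[of 0] AE_lborel_singleton[of 1]
    proof eventually_elim
      case (elim x)
      show ?case
      proof (cases "x \<in> {0..1}")
        case True
        have "ennreal ((cmod (indicator A x - P x))\<^sup>2) \<le> ennreal (2 * \<delta> + 2 * indicator (U - K) x)"
          by (rule ennreal_leI) (rule bound[OF True elim])
        also have "\<dots> = ennreal (2 * \<delta>) + 2 * indicator (U - K) x"
          using \<delta>(1) by (auto simp: indicator_def ennreal_plus)
        finally show ?thesis using True by simp
      qed simp
    qed
  qed
  also have "\<dots> = ennreal (2 * \<delta>) + 2 * emeasure lborel (U - K)"
    by (subst nn_integral_add) (auto simp: nn_integral_cmult nn_integral_cmult_indicator)
  also have "\<dots> \<le> ennreal (2 * \<delta>) + 2 * ennreal (2 * \<delta>)"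
    by (intro add_left_mono mult_left_mono UK) simp
  also have "\<dots> = ennreal (6 * \<delta>)"
    using \<delta>(1) by (simp add: ennreal_mult[symmetric] ennreal_plus[symmetric] del: ennreal_plus flip: ennreal_numeral)
  finally have "sqnorm M01 (\<lambda>x. indicator A x - P x) \<le> 6 * \<delta>" using \<delta>(1) by simp
  then have "sqnorm M01 (\<lambda>x. indicator A x - P x) < \<epsilon>" using \<delta> \<epsilon> by linarith
  with P show "\<exists>p. trig_poly p \<and> sqnorm M01 (\<lambda>x. indicator A x - p x) < \<epsilon>" by blast
qed

lemma approximable_square_integrable:
  assumes g: "square_integrable M01 g"
  shows "approximable g"
proof -
  note [measurable] = square_integrable_measurable[OF g]
  obtain s where s: "\<And>i. simple_function M01 (s i)"
    and conv: "\<And>x. x \<in> {0..1} \<Longrightarrow> (\<lambda>i. s i x) \<longlonglongrightarrow> g x"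
    and bound: "\<And>i x. x \<in> {0..1} \<Longrightarrow> cmod (s i x) \<le> 2 * cmod (g x)"
    using borel_measurable_implies_sequence_metric[OF square_integrable_measurable[OF g], of 0]
    unfolding dist_norm diff_zero space_M01 by metis
  have [measurable]: "s i \<in> borel_measurable M01" for i
    by (rule borel_measurable_simple_function[OF s])
  have sq: "square_integrable M01 (s i)" for i
    by (rule square_integrable_bound[OF g, where C=2]) (auto simp: bound)
  show ?thesis
  proof (rule approximable_limit[OF g, of s])
    fix i
    let ?A = "\<lambda>y. s i -` {y} \<inter> space M01"
    have "approximable (indicator (?A y))" for y
    proof (rule approximable_indicator)
      have "?A y \<in> sets M01" using s[of i] by (rule simple_functionD)
      then show "?A y \<in> sets borel" by (auto simp: sets_restrict_space_iff)
    qed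
    then have app: "approximable (\<lambda>x. \<Sum>y\<in>s i ` space M01. y * indicator (?A y) x)"
      by (intro approximable_sum approximable_cmult)
    have eq: "s i x = (\<Sum>y\<in>s i ` space M01. y * indicator (?A y) x)" if "x \<in> space M01" for x
      by (rule trans[OF simple_function_indicator_representation_banach[OF s that]], rule sum.cong)
        (auto simp: indicator_def)
    \<comment> \<open>The representation of \<open>s i\<close> is valid only on the unit interval. A
      constant sequence at distance zero transfers approximability to \<open>s i\<close>
      itself.\<close>
    show "approximable (s i)"
    proof (rule approximable_limit[OF sq app])
      have "sqnorm M01 (\<lambda>x. (\<Sum>y\<in>s i ` space M01. y * indicator (?A y) x) - s i x) = 0"
      proof -
        have "(LINT x|M01. (cmod ((\<Sum>y\<in>s i ` space M01. y * indicator (?A y) x) - s i x))\<^sup>2) = (LINT x|M01. 0)"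
          by (rule Bochner_Integration.integral_cong[OF refl], subst eq[symmetric]) simp_all
        then show ?thesis by (simp only: sqnorm_def integral_zero)
      qed
      then show "(\<lambda>j::nat. sqnorm M01 (\<lambda>x. (\<Sum>y\<in>s i ` space M01. y * indicator (?A y) x) - s i x)) \<longlonglongrightarrow> 0"
        by simp
    qed
  next
    \<comment> \<open>The dominating constant 9 is (2 + 1) squared, since \<open>s i\<close> is
      bounded by twice the modulus of \<open>g\<close>.\<close>
    have "(\<lambda>i. LINT x|M01. (cmod (s i x - g x))\<^sup>2) \<longlonglongrightarrow> (LINT x|M01. (cmod (g x - g x))\<^sup>2)"
    proof (rule integral_dominated_convergence[where w="\<lambda>x. 9 * (cmod (g x))\<^sup>2"])
      show "integrable M01 (\<lambda>x. 9 * (cmod (g x))\<^sup>2)" using square_integrableD[OF g] by simp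
      show "AE x in M01. (\<lambda>i. (cmod (s i x - g x))\<^sup>2) \<longlonglongrightarrow> (cmod (g x - g x))\<^sup>2"
        by (rule AE_I2, intro tendsto_intros conv) simp
      show "AE x in M01. norm ((cmod (s i x - g x))\<^sup>2) \<le> 9 * (cmod (g x))\<^sup>2" for i
      proof (rule AE_I2)
        fix x assume "x \<in> space M01"
        then have "cmod (s i x - g x) \<le> 3 * cmod (g x)"
          using norm_triangle_ineq4[of "s i x" "g x"] bound[of x i] by simp
        from power_mono[OF this, of 2] show "norm ((cmod (s i x - g x))\<^sup>2) \<le> 9 * (cmod (g x))\<^sup>2"
          by (simp add: power_mult_distrib)
      qed
    qed measurable
    then show "(\<lambda>i. sqnorm M01 (\<lambda>x. s i x - g x)) \<longlonglongrightarrow> 0" by (simp add: sqnorm_def)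
  qed
qed

lemma Parseval_unit_interval:
  assumes g: "square_integrable M01 g"
  shows "((\<lambda>m. (cmod (inner_L2 M01 (chr m) g))\<^sup>2) has_sum sqnorm M01 g) UNIV"
proof (rule Parseval_orthonormal[OF g square_integrable_chr inner_chr])
  fix \<epsilon> :: real assume "\<epsilon> > 0"
  then obtain p where "trig_poly p" "sqnorm M01 (\<lambda>x. g x - p x) < \<epsilon>"
    using approximable_square_integrable[OF g] unfolding approximable_def by blast
  then show "\<exists>S c. finite S \<and> sqnorm M01 (\<lambda>x. g x - (\<Sum>i\<in>S. c i * chr i x)) < \<epsilon>"
    using trig_poly_sum_rep[of p] by blast
qed

text \<open>Pulling back to the unit interval multiplies each squared coefficient by
  \<open>l\<^sup>2\<close> and the squared norm by 1 / l, leaving the factor \<open>l\<close>. The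
  free left endpoint accommodates translated windows.\<close>

theorem Parseval_interval:
  assumes g: "square_integrable lborel g" and l: "l > 0"
    and supp: "AE x in lborel. x \<notin> {c..c + l} \<longrightarrow> g x = 0"
  shows "(\<integral>\<^sup>+m. ennreal ((cmod (LINT x|lborel. g x * cis (- (2 * pi * of_int m * x / l))))\<^sup>2)
      \<partial>count_space UNIV) = ennreal (l * sqnorm lborel g)"
proof -
  define G where "G t = g (c + l * t)" for t
  have [measurable]: "g \<in> borel_measurable borel"
    using square_integrable_measurable[OF g] by simp
  have [measurable]: "G \<in> borel_measurable borel" unfolding G_def by measurable
  have suppG: "AE t in lborel. t \<notin> {0..1} \<longrightarrow> G t = 0"
  proof -
    have "AE t in lborel. c + l * t \<notin> {c..c + l} \<longrightarrow> g (c + l * t) = 0"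
      by (rule AE_borel_affine[OF _ _ supp]) (use l in auto)
    then show ?thesis
      by eventually_elim (use l in \<open>auto simp: G_def mult_le_cancel_left1 zero_le_mult_iff\<close>)
  qed
  have intG: "integrable lborel (\<lambda>t. (cmod (G t))\<^sup>2)"
    using lborel_integrable_real_affine[OF square_integrableD[OF g], of l c] l by (simp add: G_def)
  have sqG: "square_integrable M01 G"
    unfolding square_integrable_def
  proof
    show "G \<in> borel_measurable M01" by (rule measurable_restrict_space1) measurable
    show "integrable M01 (\<lambda>t. (cmod (G t))\<^sup>2)"
      unfolding integrable_M01_iff using integrable_mult_indicator[OF _ intG, of "{0..1}"] by simp
  qed
  have normG: "l * sqnorm M01 G = sqnorm lborel g"
  proof -
    have "sqnorm M01 G = (LINT t|lborel. (cmod (G t))\<^sup>2)"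
      unfolding sqnorm_def integral_M01
      by (rule integral_cong_AE) (use suppG in \<open>auto simp: indicator_def\<close>)
    then show ?thesis
      unfolding sqnorm_def using lborel_integral_real_affine[of l "\<lambda>x. (cmod (g x))\<^sup>2" c] l
      by (simp add: G_def)
  qed
  have coeff: "(LINT x|lborel. g x * cis (- (2 * pi * of_int m * x / l)))
      = l * cis (- (2 * pi * of_int m * c / l)) * inner_L2 M01 (chr m) G" for m
  proof -
    have "(LINT x|lborel. g x * cis (- (2 * pi * of_int m * x / l)))
       = l *\<^sub>R (LINT t|lborel. G t * cis (- (2 * pi * of_int m * (c + l * t) / l)))"
      using lborel_integral_real_affine[of l "\<lambda>x. g x * cis (- (2 * pi * of_int m * x / l))" c] l
      by (simp add: G_def)
    also have "(LINT t|lborel. G t * cis (- (2 * pi * of_int m * (c + l * t) / l)))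
       = (LINT t|lborel. cis (- (2 * pi * of_int m * c / l)) * (indicator {0..1} t *\<^sub>R (cnj (chr m t) * G t)))"
    proof (rule integral_cong_AE)
      show "AE t in lborel. G t * cis (- (2 * pi * of_int m * (c + l * t) / l)) =
          cis (- (2 * pi * of_int m * c / l)) * (indicator {0..1} t *\<^sub>R (cnj (chr m t) * G t))"
        using suppG
      proof eventually_elim
        case (elim t)
        have "cis (- (2 * pi * of_int m * (c + l * t) / l))
          = cis (- (2 * pi * of_int m * c / l)) * cnj (chr m t)"
        proof -
          have "- (2 * pi * of_int m * (c + l * t) / l)
            = - (2 * pi * of_int m * c / l) + - (2 * pi * of_int m * t)"
            using l by (simp add: field_simps)
          then show ?thesis by (simp only: chr_def cis_cnj cis_mult)
        qed
        with elim show ?case by (simp add: indicator_def)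
      qed
      show "(\<lambda>t. cis (- (2 * pi * of_int m * c / l)) * (indicator {0..1} t *\<^sub>R (cnj (chr m t) * G t)))
        \<in> borel_measurable lborel" unfolding chr_def by measurable
    qed measurable
    finally show ?thesis
      by (simp add: inner_L2_def integral_M01 scaleR_conv_of_real)
  qed
  have "((\<lambda>m. l\<^sup>2 * (cmod (inner_L2 M01 (chr m) G))\<^sup>2) has_sum l\<^sup>2 * sqnorm M01 G) UNIV"
    by (rule has_sum_cmult_right[OF Parseval_unit_interval[OF sqG]])
  also have "l\<^sup>2 * sqnorm M01 G = l * sqnorm lborel g"
    unfolding normG[symmetric] by (simp add: power2_eq_square)
  finally have sum: "((\<lambda>m. l\<^sup>2 * (cmod (inner_L2 M01 (chr m) G))\<^sup>2) has_sum l * sqnorm lborel g) UNIV" .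
  have norm: "(cmod (l * cis (- (2 * pi * of_int m * c / l)) * z))\<^sup>2 = l\<^sup>2 * (cmod z)\<^sup>2" for m :: int and z
    by (simp add: norm_mult power_mult_distrib)
  show ?thesis
    unfolding coeff norm
    by (rule iffD2[OF nn_integral_count_space_iff_has_sum sum])
      (simp_all only: zero_le_mult_iff zero_le_power2 sqnorm_nonneg less_imp_le[OF l] simp_thms)
qed

section \<open>The Plancherel theorem\<close>

lemma L2_iff: "f \<in> L2 \<longleftrightarrow> square_integrable lborel f"
  by (simp add: L2_def square_integrable_def)

text \<open>Folding the line onto one period: this turns an integral over all frequencies into an
  average of lattice sums, to which Parseval's identity applies.\<close>

lemma nn_integral_periodize:
  fixes H :: "real \<Rightarrow> ennreal"
  assumes [measurable]: "H \<in> borel_measurable borel"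
  shows "(\<integral>\<^sup>+t. H t \<partial>lborel)
    = (\<integral>\<^sup>+s. (\<integral>\<^sup>+m. H (of_int m + s) \<partial>count_space (UNIV :: int set)) * indicator {0..<1} s \<partial>lborel)"
proof -
  \<comment> \<open>The half-open cells tile the line, and the cell containing \<open>t\<close> is
    the one indexed by its floor.\<close>
  have one: "(\<integral>\<^sup>+m. indicator {0..<1} (t - of_int m) \<partial>count_space (UNIV :: int set)) = (1 :: ennreal)" for t :: real
  proof -
    have "(indicator {0..<1} (t - of_int m) :: ennreal) = indicator {\<lfloor>t\<rfloor>} m" for m :: int
    proof -
      have "t - of_int m \<in> {0..<1} \<longleftrightarrow> m = \<lfloor>t\<rfloor>"
        by (subst eq_commute, subst floor_eq_iff) auto
      then show ?thesis by (simp add: indicator_def)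
    qed
    then show ?thesis by simp
  qed
  have "(\<integral>\<^sup>+t. H t \<partial>lborel)
      = (\<integral>\<^sup>+t. (\<integral>\<^sup>+m. H t * indicator {0..<1} (t - of_int m) \<partial>count_space (UNIV :: int set)) \<partial>lborel)"
    by (simp add: nn_integral_cmult one)
  also have "\<dots> = (\<integral>\<^sup>+m. (\<integral>\<^sup>+t. H t * indicator {0..<1} (t - of_int m) \<partial>lborel) \<partial>count_space (UNIV :: int set))"
    by (rule nn_integral_count_space_nn_integral) auto
  also have "\<dots> = (\<integral>\<^sup>+m. (\<integral>\<^sup>+s. H (of_int m + s) * indicator {0..<1} s \<partial>lborel) \<partial>count_space (UNIV :: int set))"
  proof (rule nn_integral_cong)
    fix m :: int
    show "(\<integral>\<^sup>+t. H t * indicator {0..<1} (t - of_int m) \<partial>lborel)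
        = (\<integral>\<^sup>+s. H (of_int m + s) * indicator {0..<1} s \<partial>lborel)"
      using nn_integral_real_affine[of "\<lambda>t. H t * indicator {0..<1} (t - of_int m)" 1 "of_int m"]
      by simp
  qed
  also have "\<dots> = (\<integral>\<^sup>+s. (\<integral>\<^sup>+m. H (of_int m + s) * indicator {0..<1} s \<partial>count_space (UNIV :: int set)) \<partial>lborel)"
    by (rule nn_integral_count_space_nn_integral[symmetric]) auto
  also have "\<dots> = (\<integral>\<^sup>+s. (\<integral>\<^sup>+m. H (of_int m + s) \<partial>count_space (UNIV :: int set)) * indicator {0..<1} s \<partial>lborel)"
    by (simp add: nn_integral_multc)
  finally show ?thesis .
qed

lemma square_integrable_indicator_Icc: "square_integrable lborel (indicator {a..b::real})"
proof -
  have "integrable lborel (indicator {a..b} :: real \<Rightarrow> real)"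
    by (rule integrable_real_indicator) (auto simp: emeasure_lborel_Icc_eq)
  moreover have "(\<lambda>x. (cmod (indicator {a..b} x))\<^sup>2) = (indicator {a..b} :: real \<Rightarrow> real)"
    by (auto simp: indicator_def)
  ultimately show ?thesis by (simp add: square_integrable_def)
qed

lemma fourier_integral_measurable [measurable]:
  assumes [measurable]: "f \<in> borel_measurable borel"
  shows "fourier_integral f \<in> borel_measurable borel"
  unfolding fourier_integral_def by measurable

lemma Plancherel_bounded_support:
  assumes f: "square_integrable lborel f" and R: "R > 0"
    and supp: "AE x in lborel. x \<notin> {-R..R} \<longrightarrow> f x = 0"
  shows "square_integrable lborel (fourier_integral f)"
    and "sqnorm lborel (fourier_integral f) = sqnorm lborel f"
proof -
  define l where "l = 2 * R"
  have l: "l > 0" using R by (simp add: l_def)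
  have [measurable]: "f \<in> borel_measurable borel" using square_integrable_measurable[OF f] by simp
  have sum: "(\<integral>\<^sup>+m. ennreal ((cmod (fourier_integral f (2 * pi / l * (of_int m + s))))\<^sup>2)
      \<partial>count_space (UNIV :: int set)) = ennreal (l / (2 * pi) * sqnorm lborel f)" for s
  proof -
    \<comment> \<open>Shifting the frequency lattice by \<open>s\<close> amounts to modulating
      \<open>f\<close>. The modulus is unchanged, so the lattice sum has the same value for every
      \<open>s\<close>.\<close>
    define g where "g x = f x * cis (- (2 * pi * s * x / l))" for x
    have norm_g: "cmod (g x) = cmod (f x)" for x by (simp add: g_def norm_mult)
    have [measurable]: "g \<in> borel_measurable lborel" unfolding g_def by measurable
    have g: "square_integrable lborel g"
      by (rule square_integrable_bound[OF f, where C=1]) (simp_all add: norm_g)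
    have "fourier_integral f (2 * pi / l * (of_int m + s))
       = of_real (1 / sqrt (2 * pi)) * (LINT x|lborel. g x * cis (- (2 * pi * of_int m * x / l)))" for m :: int
    proof -
      have "f x * cis (- (2 * pi / l * (of_int m + s) * x)) = g x * cis (- (2 * pi * of_int m * x / l))" for x
      proof -
        have "- (2 * pi / l * (of_int m + s) * x) = - (2 * pi * s * x / l) + - (2 * pi * of_int m * x / l)"
          using l by (simp add: field_simps)
        then show ?thesis by (simp only: g_def mult.assoc cis_mult)
      qed
      then show ?thesis unfolding fourier_integral_def by simp
    qed
    then have "(\<integral>\<^sup>+m. ennreal ((cmod (fourier_integral f (2 * pi / l * (of_int m + s))))\<^sup>2) \<partial>count_space (UNIV :: int set))
      = (\<integral>\<^sup>+m. ennreal (1 / (2 * pi)) * ennreal ((cmod (LINT x|lborel. g x * cis (- (2 * pi * of_int m * x / l))))\<^sup>2)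
          \<partial>count_space UNIV)"
      by (intro nn_integral_cong)
        (simp add: norm_mult power_mult_distrib power_divide norm_divide flip: ennreal_mult)
    also have "\<dots> = ennreal (1 / (2 * pi)) * ennreal (l * sqnorm lborel g)"
    proof (subst nn_integral_cmult)
      have "AE x in lborel. x \<notin> {-R..-R + l} \<longrightarrow> g x = 0"
        using supp by eventually_elim (auto simp: g_def l_def)
      from Parseval_interval[OF g l this]
      show "ennreal (1 / (2 * pi)) * (\<integral>\<^sup>+m. ennreal ((cmod (LINT x|lborel. g x * cis (- (2 * pi * of_int m * x / l))))\<^sup>2)
          \<partial>count_space UNIV) = ennreal (1 / (2 * pi)) * ennreal (l * sqnorm lborel g)" by simp
    qed simp
    also have "sqnorm lborel g = sqnorm lborel f" by (simp add: sqnorm_def norm_g)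
    also have "ennreal (1 / (2 * pi)) * ennreal (l * sqnorm lborel f) = ennreal (l / (2 * pi) * sqnorm lborel f)"
      using l by (simp flip: ennreal_mult)
    finally show ?thesis .
  qed
  have "(\<integral>\<^sup>+w. ennreal ((cmod (fourier_integral f w))\<^sup>2) \<partial>lborel)
      = ennreal (2 * pi / l) * (\<integral>\<^sup>+t. ennreal ((cmod (fourier_integral f (2 * pi / l * t)))\<^sup>2) \<partial>lborel)"
    using nn_integral_real_affine[of "\<lambda>w. ennreal ((cmod (fourier_integral f w))\<^sup>2)" "2 * pi / l" 0] l by simp
  also have "(\<integral>\<^sup>+t. ennreal ((cmod (fourier_integral f (2 * pi / l * t)))\<^sup>2) \<partial>lborel)
      = (\<integral>\<^sup>+s. ennreal (l / (2 * pi) * sqnorm lborel f) * indicator {0..<1::real} s \<partial>lborel)"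
    by (subst nn_integral_periodize) (simp_all only: sum, measurable)
  also have "\<dots> = ennreal (l / (2 * pi) * sqnorm lborel f)"
    by (simp add: nn_integral_cmult_indicator)
  also have "ennreal (2 * pi / l) * ennreal (l / (2 * pi) * sqnorm lborel f) = ennreal (sqnorm lborel f)"
    using l by (simp flip: ennreal_mult)
  finally have eq: "(\<integral>\<^sup>+w. ennreal ((cmod (fourier_integral f w))\<^sup>2) \<partial>lborel) = ennreal (sqnorm lborel f)" .
  then show sq: "square_integrable lborel (fourier_integral f)"
    by (intro square_integrableI_nn) auto
  from eq show "sqnorm lborel (fourier_integral f) = sqnorm lborel f"
    by (simp add: nn_integral_sqnorm[OF sq])
qed

section \<open>Extension of the Fourier transform to all square-integrable functions\<close>

abbreviation truncate :: "real \<Rightarrow> (real \<Rightarrow> complex) \<Rightarrow> real \<Rightarrow> complex" where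
  "truncate R f \<equiv> (\<lambda>x. indicator {-R..R} x * f x)"

lemma square_integrable_truncate [simp]:
  assumes "square_integrable lborel f"
  shows "square_integrable lborel (truncate R f)"
proof (rule square_integrable_bound[OF assms, where C=1])
  note [measurable] = square_integrable_measurable[OF assms]
  show "truncate R f \<in> borel_measurable lborel" by measurable
qed (auto simp: indicator_def)

lemma integrable_truncate [simp]:
  "square_integrable lborel f \<Longrightarrow> integrable lborel (truncate R f)"
  by (rule square_integrable_mult_integrable[OF square_integrable_indicator_Icc])

lemma truncate_Plancherel:
  assumes "square_integrable lborel f"
  shows "square_integrable lborel (fourier_integral (truncate R f))"
    and "sqnorm lborel (fourier_integral (truncate R f)) = sqnorm lborel (truncate R f)"
proof -
  \<comment> \<open>\<open>R\<close> may be zero or negative, whereas the bounded-support theorem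
    asks for a positive radius.\<close>
  have supp: "AE x in lborel. x \<notin> {-(\<bar>R\<bar> + 1)..\<bar>R\<bar> + 1} \<longrightarrow> truncate R f x = 0"
    by (rule AE_I2) (auto simp: indicator_def)
  note P = Plancherel_bounded_support[OF square_integrable_truncate[OF assms] _ supp]
  show "square_integrable lborel (fourier_integral (truncate R f))" by (rule P(1)) simp
  show "sqnorm lborel (fourier_integral (truncate R f)) = sqnorm lborel (truncate R f)"
    by (rule P(2)) simp
qed

lemma fourier_integral_add_cmult:
  assumes "integrable lborel f" "integrable lborel g"
  shows "fourier_integral (\<lambda>x. f x + c * g x) w = fourier_integral f w + c * fourier_integral g w"
proof -
  have int: "integrable lborel (\<lambda>x. h x * cis (- (w * x)))" if "integrable lborel h" for h :: "real \<Rightarrow> complex"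
  proof (rule Bochner_Integration.integrable_bound[OF that])
    note [measurable] = borel_measurable_integrable[OF that]
    show "(\<lambda>x. h x * cis (- (w * x))) \<in> borel_measurable lborel" by measurable
  qed (auto simp: norm_mult)
  have "(LINT x|lborel. (f x + c * g x) * cis (- (w * x)))
      = (LINT x|lborel. f x * cis (- (w * x)) + c * (g x * cis (- (w * x))))"
    by (simp add: algebra_simps)
  also have "\<dots> = (LINT x|lborel. f x * cis (- (w * x))) + c * (LINT x|lborel. g x * cis (- (w * x)))"
    using int[OF assms(1)] int[OF assms(2)] by simp
  finally show ?thesis by (simp add: fourier_integral_def algebra_simps)
qed

lemma tendsto_truncate:
  assumes f: "square_integrable lborel f"
  shows "((\<lambda>R. sqnorm lborel (\<lambda>x. truncate R f x - f x)) \<longlongrightarrow> 0) at_top"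
proof -
  note [measurable] = square_integrable_measurable[OF f]
  have "((\<lambda>R. LINT x|lborel. (cmod (truncate R f x - f x))\<^sup>2) \<longlongrightarrow> (LINT x|(lborel::real measure). 0)) at_top"
  proof (rule integral_dominated_convergence_at_top[where w="\<lambda>x. (cmod (f x))\<^sup>2"])
    show "AE x in lborel. ((\<lambda>R. (cmod (truncate R f x - f x))\<^sup>2) \<longlongrightarrow> 0) at_top"
    proof (rule AE_I2)
      fix x
      have "\<forall>\<^sub>F R in at_top. (cmod (truncate R f x - f x))\<^sup>2 = 0"
        using eventually_ge_at_top[of "\<bar>x\<bar>"]
        by eventually_elim (auto simp: indicator_def)
      then show "((\<lambda>R. (cmod (truncate R f x - f x))\<^sup>2) \<longlongrightarrow> 0) at_top" by (rule tendsto_eventually)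
    qed
    show "integrable lborel (\<lambda>x. (cmod (f x))\<^sup>2)" using square_integrableD[OF f] .
    show "\<forall>\<^sub>F R in at_top. AE x in lborel. norm ((cmod (truncate R f x - f x))\<^sup>2) \<le> (cmod (f x))\<^sup>2"
      by (intro always_eventually allI AE_I2) (auto simp: indicator_def)
  qed measurable
  then show ?thesis by (simp add: sqnorm_def)
qed

lemma is_fourier_transform_iff:
  assumes f: "square_integrable lborel f"
  shows "is_fourier_transform f g \<longleftrightarrow> square_integrable lborel g \<and>
    ((\<lambda>R. sqnorm lborel (\<lambda>w. fourier_integral (truncate R f) w - g w)) \<longlongrightarrow> 0) at_top"
proof -
  have "((\<lambda>R. \<integral>\<^sup>+w. ennreal ((cmod (fourier_integral (truncate R f) w - g w))\<^sup>2) \<partial>lborel) \<longlongrightarrow> 0) at_top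
    \<longleftrightarrow> ((\<lambda>R. sqnorm lborel (\<lambda>w. fourier_integral (truncate R f) w - g w)) \<longlongrightarrow> 0) at_top"
    if g: "square_integrable lborel g"
  proof -
    have "((\<lambda>R. \<integral>\<^sup>+w. ennreal ((cmod (fourier_integral (truncate R f) w - g w))\<^sup>2) \<partial>lborel) \<longlongrightarrow> 0) at_top
      \<longleftrightarrow> ((\<lambda>R. ennreal (sqnorm lborel (\<lambda>w. fourier_integral (truncate R f) w - g w))) \<longlongrightarrow> ennreal 0) at_top"
      by (subst nn_integral_sqnorm) (auto intro!: square_integrable_diff truncate_Plancherel f g)
    also have "\<dots> \<longleftrightarrow> ((\<lambda>R. sqnorm lborel (\<lambda>w. fourier_integral (truncate R f) w - g w)) \<longlongrightarrow> 0) at_top"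
      by (rule tendsto_ennreal_iff) auto
    finally show ?thesis .
  qed
  then show ?thesis unfolding is_fourier_transform_def L2_iff by blast
qed

lemma sqnorm_fourier_integral_diff:
  assumes f: "square_integrable lborel f"
  shows "sqnorm lborel (\<lambda>w. fourier_integral (truncate R f) w - fourier_integral (truncate S f) w)
    = sqnorm lborel (\<lambda>x. truncate R f x - truncate S f x)"
proof -
  let ?d = "\<lambda>x. truncate R f x - truncate S f x"
  have "(\<lambda>w. fourier_integral (truncate R f) w - fourier_integral (truncate S f) w) = fourier_integral ?d"
    using fourier_integral_add_cmult[OF integrable_truncate[OF f] integrable_truncate[OF f], of R "-1" S]
    by auto
  moreover have "sqnorm lborel (fourier_integral ?d) = sqnorm lborel ?d"
  proof (rule Plancherel_bounded_support(2)[where R="max \<bar>R\<bar> \<bar>S\<bar> + 1"])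
    show "AE x in lborel. x \<notin> {- (max \<bar>R\<bar> \<bar>S\<bar> + 1)..max \<bar>R\<bar> \<bar>S\<bar> + 1} \<longrightarrow> ?d x = 0"
      by (rule AE_I2) (auto simp: indicator_def)
  qed (use f in auto)
  ultimately show ?thesis by simp
qed

text \<open>On truncations the transform is isometric, so their transforms inherit the Cauchy
  property of the truncations themselves.\<close>

lemma is_fourier_transform_exists:
  assumes f: "square_integrable lborel f"
  shows "\<exists>g. is_fourier_transform f g"
proof -
  let ?u = "\<lambda>R. fourier_integral (truncate R f)"
  let ?t = "\<lambda>R. sqnorm lborel (\<lambda>x. truncate R f x - f x)"
  have d_le: "sqnorm lborel (\<lambda>w. ?u R w - ?u S w) \<le> 2 * ?t R + 2 * ?t S" for R S
    unfolding sqnorm_fourier_integral_diff[OF f]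
    using sqnorm_triangle[of lborel "truncate R f" f "truncate S f"] f
      sqnorm_minus_commute[of lborel f "truncate S f"] by simp
  have lim: "(\<lambda>n. ?t (real n)) \<longlonglongrightarrow> 0"
    by (rule filterlim_compose[OF tendsto_truncate[OF f] filterlim_real_sequentially])
  obtain g where g: "square_integrable lborel g"
    and lim_g: "(\<lambda>n. sqnorm lborel (\<lambda>w. ?u (real n) w - g w)) \<longlonglongrightarrow> 0"
  proof -
    have "\<exists>N. \<forall>m\<ge>N. \<forall>n\<ge>N. sqnorm lborel (\<lambda>w. ?u (real m) w - ?u (real n) w) < e" if "e > 0" for e
    proof -
      from order_tendstoD(2)[OF lim, of "e / 4"] that obtain N where N: "\<And>n. n \<ge> N \<Longrightarrow> ?t (real n) < e / 4"
        by (auto simp: eventually_sequentially)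
      have "sqnorm lborel (\<lambda>w. ?u (real m) w - ?u (real n) w) < e" if "m \<ge> N" "n \<ge> N" for m n
        using d_le[of "real m" "real n"] N[OF that(1)] N[OF that(2)] by linarith
      then show ?thesis by blast
    qed
    then show thesis
      using square_integrable_complete[of lborel "\<lambda>n. ?u (real n)"] truncate_Plancherel(1)[OF f] that by blast
  qed
  \<comment> \<open>Completeness yielded a limit along integer radii only. Comparing with radius
    \<open>n\<close> and letting \<open>n\<close> grow gives a bound for every real
    \<open>R\<close>; the 4 arises from two applications of the factor-2 triangle
    inequality.\<close>
  have le: "sqnorm lborel (\<lambda>w. ?u R w - g w) \<le> 4 * ?t R" for R
  proof (rule LIMSEQ_le_const)
    show "(\<lambda>n. 2 * (2 * ?t R + 2 * ?t (real n)) + 2 * sqnorm lborel (\<lambda>w. ?u (real n) w - g w)) \<longlonglongrightarrow> 4 * ?t R"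
      using lim lim_g by (auto intro!: tendsto_eq_intros)
    have "sqnorm lborel (\<lambda>w. ?u R w - g w)
        \<le> 2 * (2 * ?t R + 2 * ?t (real n)) + 2 * sqnorm lborel (\<lambda>w. ?u (real n) w - g w)" for n
      by (rule order_trans[OF sqnorm_triangle[OF truncate_Plancherel(1)[OF f] truncate_Plancherel(1)[OF f, of "real n"] g]])
        (intro add_right_mono mult_left_mono d_le zero_le_numeral)
    then show "\<exists>N. \<forall>n\<ge>N. sqnorm lborel (\<lambda>w. ?u R w - g w)
        \<le> 2 * (2 * ?t R + 2 * ?t (real n)) + 2 * sqnorm lborel (\<lambda>w. ?u (real n) w - g w)" by blast
  qed
  have "((\<lambda>R. 4 * ?t R) \<longlongrightarrow> 0) at_top"
    using tendsto_mult_left[OF tendsto_truncate[OF f], of 4] by simp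
  then have "((\<lambda>R. sqnorm lborel (\<lambda>w. ?u R w - g w)) \<longlongrightarrow> 0) at_top"
    by (rule tendsto_sandwich[OF always_eventually always_eventually tendsto_const, rotated 2])
      (intro allI sqnorm_nonneg le)+
  then show ?thesis using g is_fourier_transform_iff[OF f] by blast
qed

lemma is_fourier_transform_F:
  "square_integrable lborel f \<Longrightarrow> is_fourier_transform f (\<F> f)"
  unfolding \<F>_def by (rule someI_ex[OF is_fourier_transform_exists])

lemma square_integrable_F [simp]:
  "square_integrable lborel f \<Longrightarrow> square_integrable lborel (\<F> f)"
  using is_fourier_transform_F is_fourier_transform_iff by blast

text \<open>Both norms are limits of the same quantity, the norm of a truncation. Allowing any
  representative \<open>g\<close> permits its use on linear combinations.\<close>

lemma sqnorm_fourier_transform: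
  assumes f: "square_integrable lborel f" and g: "is_fourier_transform f g"
  shows "sqnorm lborel g = sqnorm lborel f"
proof (rule tendsto_unique[OF trivial_limit_at_top_linorder])
  from g have "square_integrable lborel g"
    "((\<lambda>R. sqnorm lborel (\<lambda>w. fourier_integral (truncate R f) w - g w)) \<longlongrightarrow> 0) at_top"
    by (auto simp: is_fourier_transform_iff[OF f])
  then show "((\<lambda>R. sqnorm lborel (fourier_integral (truncate R f))) \<longlongrightarrow> sqnorm lborel g) at_top"
    using truncate_Plancherel(1)[OF f] by (intro tendsto_sqnorm)
  show "((\<lambda>R. sqnorm lborel (fourier_integral (truncate R f))) \<longlongrightarrow> sqnorm lborel f) at_top"
    unfolding truncate_Plancherel(2)[OF f]
    using f tendsto_truncate[OF f] by (intro tendsto_sqnorm) auto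
qed

text \<open>Since \<open>\<F>\<close> selects representatives arbitrarily, linearity is stated for
  the relation instead of pointwise for the chosen functions.\<close>

lemma is_fourier_transform_add_cmult:
  assumes f: "square_integrable lborel f" "square_integrable lborel f'"
    and g: "is_fourier_transform f g" "is_fourier_transform f' g'"
  shows "is_fourier_transform (\<lambda>x. f x + c * f' x) (\<lambda>w. g w + c * g' w)"
proof -
  have eq: "fourier_integral (truncate R (\<lambda>x. f x + c * f' x)) =
      (\<lambda>w. fourier_integral (truncate R f) w + c * fourier_integral (truncate R f') w)" for R
    using fourier_integral_add_cmult[OF integrable_truncate[OF f(1)] integrable_truncate[OF f(2)], of R c R]
    by (intro ext) (simp add: distrib_left mult.left_commute)
  show ?thesis
    using f g truncate_Plancherel(1)[OF f(1)] truncate_Plancherel(1)[OF f(2)]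
    by (subst is_fourier_transform_iff)
      (auto simp: is_fourier_transform_iff eq intro!: tendsto_sqnorm_add)
qed

theorem Plancherel:
  assumes f: "square_integrable lborel f" and g: "square_integrable lborel g"
  shows "inner_L2 lborel (\<F> f) (\<F> g) = inner_L2 lborel f g"
proof -
  have "sqnorm lborel (\<lambda>w. \<F> f w + c * \<F> g w) = sqnorm lborel (\<lambda>x. f x + c * g x)" for c
    using f g by (intro sqnorm_fourier_transform is_fourier_transform_add_cmult is_fourier_transform_F) auto
  \<comment> \<open>The two values of \<open>c\<close> supply the real and the imaginary part in the
    polarization identity.\<close>
  from this[of 1] this[of \<i>] show ?thesis
    using f g by (simp add: polarization_L2 sqnorm_fourier_transform is_fourier_transform_F)
qed

text \<open>Fubini, with a kernel symmetric in \<open>x\<close> and \<open>w\<close>.\<close>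

lemma fourier_integral_multiplication:
  assumes h: "integrable lborel h" and k: "integrable lborel k"
  shows "(LINT w|lborel. fourier_integral h w * k w) = (LINT x|lborel. h x * fourier_integral k x)"
proof -
  note [measurable] = borel_measurable_integrable[OF h] borel_measurable_integrable[OF k]
  define T where "T = (\<lambda>(x, w). h x * cis (- (w * x)) * k w)"
  have [measurable]: "T \<in> borel_measurable (lborel \<Otimes>\<^sub>M lborel)" unfolding T_def by measurable
  have int: "integrable (lborel \<Otimes>\<^sub>M lborel) T"
  proof (rule lborel_pair.Fubini_integrable)
    show "integrable lborel (\<lambda>x. LINT w|lborel. norm (T (x, w)))"
      using h k by (simp add: T_def norm_mult)
    have "integrable lborel (\<lambda>w. T (x, w))" for x
      by (rule Bochner_Integration.integrable_bound[OF integrable_mult_right[OF k, of "h x"]])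
        (auto simp: T_def norm_mult)
    then show "AE x in lborel. integrable lborel (\<lambda>w. T (x, w))" by simp
  qed measurable
  have "(LINT w|lborel. (LINT x|lborel. T (x, w))) = (LINT x|lborel. (LINT w|lborel. T (x, w)))"
    using lborel_pair.Fubini_integral[of "\<lambda>x w. T (x, w)"] int by simp
  moreover have "(LINT w|lborel. (LINT x|lborel. T (x, w))) * (1 / sqrt (2 * pi))
      = (LINT w|lborel. fourier_integral h w * k w)"
    unfolding T_def fourier_integral_def by (simp add: field_simps flip: integral_mult_right_zero integral_mult_left_zero)
  moreover have "(LINT x|lborel. (LINT w|lborel. T (x, w))) * (1 / sqrt (2 * pi))
      = (LINT x|lborel. h x * fourier_integral k x)"
    unfolding T_def fourier_integral_def by (simp add: field_simps flip: integral_mult_right_zero integral_mult_left_zero)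
  ultimately show ?thesis by simp
qed

text \<open>The multiplication formula passes to the limit along truncations. The conjugations
  cancel the one built into \<open>inner_L2\<close>, making the pairing bilinear.\<close>

lemma fourier_transform_multiplication:
  assumes f: "square_integrable lborel f" and g: "square_integrable lborel g"
  shows "inner_L2 lborel (\<lambda>w. cnj (\<F> f w)) g = inner_L2 lborel (\<lambda>x. cnj (f x)) (\<F> g)"
proof (rule tendsto_unique[OF trivial_limit_at_top_linorder])
  note F = is_fourier_transform_F[OF f, unfolded is_fourier_transform_iff[OF f]]
    is_fourier_transform_F[OF g, unfolded is_fourier_transform_iff[OF g]]
  have cnj: "sqnorm lborel (\<lambda>x. cnj (u x) - cnj (v x)) = sqnorm lborel (\<lambda>x. u x - v x)" for u v
    using sqnorm_cnj[of lborel "\<lambda>x. u x - v x"] by simp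
  show "((\<lambda>R. inner_L2 lborel (\<lambda>w. cnj (fourier_integral (truncate R f) w)) (truncate R g))
      \<longlongrightarrow> inner_L2 lborel (\<lambda>w. cnj (\<F> f w)) g) at_top"
    by (rule tendsto_inner_L2)
      (use F f g tendsto_truncate[OF g] truncate_Plancherel(1)[OF f] in \<open>auto simp: cnj\<close>)
  have "((\<lambda>R. inner_L2 lborel (\<lambda>x. cnj (truncate R f x)) (fourier_integral (truncate R g)))
      \<longlongrightarrow> inner_L2 lborel (\<lambda>x. cnj (f x)) (\<F> g)) at_top"
    by (rule tendsto_inner_L2, unfold cnj)
      (use F f g tendsto_truncate[OF f] truncate_Plancherel(1)[OF g] in \<open>auto simp del: complex_cnj_mult\<close>)
  moreover have "inner_L2 lborel (\<lambda>x. cnj (truncate R f x)) (fourier_integral (truncate R g))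
      = inner_L2 lborel (\<lambda>w. cnj (fourier_integral (truncate R f) w)) (truncate R g)" for R
    unfolding inner_L2_def complex_cnj_cnj
    by (rule fourier_integral_multiplication[symmetric]) (use f g in auto)
  ultimately show "((\<lambda>R. inner_L2 lborel (\<lambda>w. cnj (fourier_integral (truncate R f) w)) (truncate R g))
      \<longlongrightarrow> inner_L2 lborel (\<lambda>x. cnj (f x)) (\<F> g)) at_top" by simp
qed

text \<open>The conjugate of the transform of \<open>cnj G\<close> is the inverse transform of \<open>G\<close>.\<close>

theorem fourier_transform_surjective:
  assumes G: "square_integrable lborel G"
  shows "\<exists>h. square_integrable lborel h \<and> (AE w in lborel. \<F> h w = G w)"
proof -
  define k where "k = \<F> (\<lambda>x. cnj (G x))"
  define h where "h = (\<lambda>x. cnj (k x))"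
  have k: "square_integrable lborel k" unfolding k_def using G by simp
  then have h: "square_integrable lborel h" unfolding h_def by simp
  have norm_k: "sqnorm lborel k = sqnorm lborel G"
    unfolding k_def using sqnorm_fourier_transform[OF _ is_fourier_transform_F] G by simp
  have norm_F: "sqnorm lborel (\<F> h) = sqnorm lborel G"
    using sqnorm_fourier_transform[OF h is_fourier_transform_F[OF h]] norm_k by (simp add: h_def)
  \<comment> \<open>The multiplication formula moves the transform from \<open>h\<close> onto
    \<open>cnj G\<close>, where it becomes \<open>k\<close>.\<close>
  have "inner_L2 lborel G (\<F> h) = inner_L2 lborel (\<lambda>w. cnj (\<F> h w)) (\<lambda>x. cnj (G x))"
    by (simp add: inner_L2_def mult.commute)
  also have "\<dots> = inner_L2 lborel k k"
    using fourier_transform_multiplication[OF h square_integrable_cnj[OF G]]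
    by (simp add: h_def flip: k_def)
  finally have "inner_L2 lborel G (\<F> h) = of_real (sqnorm lborel G)"
    by (simp add: inner_L2_self norm_k)
  \<comment> \<open>Both norms and the inner product equal the squared norm of \<open>G\<close>, so
    the expanded squared distance cancels completely.\<close>
  then have "sqnorm lborel (\<lambda>w. \<F> h w - G w) = 0"
    using sqnorm_diff[OF square_integrable_F[OF h] G] inner_L2_commute[of lborel "\<F> h" G]
    by (simp add: norm_F)
  then have "AE w in lborel. \<F> h w - G w = 0"
    using sqnorm_eq_0_iff[OF square_integrable_diff[OF square_integrable_F[OF h] G]] by simp
  then show ?thesis using h by auto
qed

section \<open>The operator \<open>I_op\<close> and the two families of coefficients\<close>

lemma incseq_mult_indicator:
  fixes g :: "'a \<Rightarrow> ennreal"
  assumes "\<And>m n. m \<le> n \<Longrightarrow> S m \<subseteq> S n"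
  shows "incseq (\<lambda>n x. g x * indicator (S n) x)"
proof (intro monoI le_funI mult_left_mono zero_le)
  fix m n :: nat and x assume "m \<le> n"
  from assms[OF this] show "indicator (S m) x \<le> (indicator (S n) x :: ennreal)"
    by (auto simp: indicator_def)
qed

text \<open>Substitution by the increasing map exp (e x) on compact intervals, then monotone
  convergence, and finally a reflection of \<open>x\<close> to obtain the decreasing map.\<close>

lemma nn_integral_exp_substitution:
  fixes f :: "real \<Rightarrow> ennreal"
  assumes [measurable]: "f \<in> borel_measurable borel" and e: "e > 0"
  shows "(\<integral>\<^sup>+u. f u * indicator {0<..} u \<partial>lborel)
    = (\<integral>\<^sup>+x. f (exp (- (e * x))) * ennreal (e * exp (- (e * x))) \<partial>lborel)"
proof -
  \<comment> \<open>\<open>Suc\<close> keeps every interval nondegenerate.\<close>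
  let ?I = "\<lambda>n::nat. {exp (e * - real (Suc n))..exp (e * real (Suc n))}"
  let ?J = "\<lambda>n::nat. {- real (Suc n)..real (Suc n)}"
  have sub: "(\<integral>\<^sup>+u. f u * indicator (?I n) u \<partial>lborel)
      = (\<integral>\<^sup>+x. f (exp (e * x)) * ennreal (e * exp (e * x)) * indicator (?J n) x \<partial>lborel)" for n
  proof (rule nn_integral_substitution_aux[where g="\<lambda>x. exp (e * x)" and g'="\<lambda>x. e * exp (e * x)"])
    show "((\<lambda>x. exp (e * x)) has_real_derivative e * exp (e * x)) (at x)" for x
      by (auto intro!: derivative_eq_intros)
    show "continuous_on {- real (Suc n)..real (Suc n)} (\<lambda>x. e * exp (e * x))"
      by (intro continuous_intros)
  qed (use e in auto)
  have ev_I: "\<forall>\<^sub>F n in sequentially. indicator (?I n) u = (indicator {0<..} u :: ennreal)" for u :: real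
  proof (cases "u > 0")
    case True
    have "\<forall>\<^sub>F n in sequentially. real (Suc n) \<ge> \<bar>ln u\<bar> / e"
      using eventually_ge_at_top[of "nat \<lceil>\<bar>ln u\<bar> / e\<rceil>"]
      by eventually_elim linarith
    then show ?thesis
    proof eventually_elim
      case (elim n)
      then have "\<bar>ln u\<bar> \<le> e * real (Suc n)" using e by (simp add: field_simps)
      then have "e * - real (Suc n) \<le> ln u" "ln u \<le> e * real (Suc n)" by (simp_all only: abs_le_iff mult_minus_right minus_le_iff)
      then have "exp (e * - real (Suc n)) \<le> exp (ln u)" "exp (ln u) \<le> exp (e * real (Suc n))"
        by (simp_all only: exp_le_cancel_iff)
      then have "u \<in> ?I n" using True by simp
      then show ?case using True by simp
    qed
  next
    case False
    have "u \<notin> ?I n" for n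
      using False exp_gt_zero[of "e * - real (Suc n)"] by (meson atLeastAtMost_iff less_le_trans)
    then show ?thesis using False by simp
  qed
  have ev_J: "\<forall>\<^sub>F n in sequentially. indicator (?J n) x = (1 :: ennreal)" for x :: real
    using eventually_ge_at_top[of "nat \<lceil>\<bar>x\<bar>\<rceil>"]
    by eventually_elim (simp add: indicator_def, linarith)
  have "(\<lambda>n. \<integral>\<^sup>+u. f u * indicator (?I n) u \<partial>lborel) \<longlonglongrightarrow> (\<integral>\<^sup>+u. f u * indicator {0<..} u \<partial>lborel)"
  proof (rule nn_integral_LIMSEQ)
    have "?I m \<subseteq> ?I n" if "m \<le> n" for m n
      using that e by (intro atLeastatMost_subset_iff[THEN iffD2] disjI2 conjI) auto
    then show "incseq (\<lambda>n u. f u * indicator (?I n) u)"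
      by (rule incseq_mult_indicator)
    show "(\<lambda>n. f u * indicator (?I n) u) \<longlonglongrightarrow> f u * indicator {0<..} u" for u
      by (rule tendsto_eventually) (rule eventually_mono[OF ev_I[of u]], simp)
  qed measurable
  moreover have "(\<lambda>n. \<integral>\<^sup>+x. f (exp (e * x)) * ennreal (e * exp (e * x)) * indicator (?J n) x \<partial>lborel)
      \<longlonglongrightarrow> (\<integral>\<^sup>+x. f (exp (e * x)) * ennreal (e * exp (e * x)) \<partial>lborel)"
  proof (rule nn_integral_LIMSEQ)
    have "?J m \<subseteq> ?J n" if "m \<le> n" for m n
      using that by auto
    then show "incseq (\<lambda>n x. f (exp (e * x)) * ennreal (e * exp (e * x)) * indicator (?J n) x)"
      by (rule incseq_mult_indicator)
    show "(\<lambda>n. f (exp (e * x)) * ennreal (e * exp (e * x)) * indicator (?J n) x)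
        \<longlonglongrightarrow> f (exp (e * x)) * ennreal (e * exp (e * x))" for x
      by (rule tendsto_eventually) (rule eventually_mono[OF ev_J[of x]], simp)
  qed measurable
  ultimately have "(\<integral>\<^sup>+u. f u * indicator {0<..} u \<partial>lborel)
      = (\<integral>\<^sup>+x. f (exp (e * x)) * ennreal (e * exp (e * x)) \<partial>lborel)"
    unfolding sub by (rule LIMSEQ_unique)
  also have "\<dots> = (\<integral>\<^sup>+x. f (exp (- (e * x))) * ennreal (e * exp (- (e * x))) \<partial>lborel)"
    using nn_integral_real_affine[of "\<lambda>x. f (exp (e * x)) * ennreal (e * exp (e * x))" "-1" 0] by simp
  finally show ?thesis .
qed

text \<open>As an identity of measures the substitution extends from nonnegative to complex
  integrands.\<close>

lemma density_exp_substitution: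
  assumes e: "e > 0"
  shows "density lborel (\<lambda>u. ennreal (indicator {0<..} u))
    = distr (density lborel (\<lambda>x. ennreal (e * exp (- (e * x))))) borel (\<lambda>x. exp (- (e * x)))"
proof (rule measure_eqI)
  fix A :: "real set" assume "A \<in> sets (density lborel (\<lambda>u. ennreal (indicator {0<..} u)))"
  then have [measurable]: "A \<in> sets borel" by simp
  have "emeasure (density lborel (\<lambda>u. ennreal (indicator {0<..} u))) A
      = (\<integral>\<^sup>+u. indicator A u * indicator {0<..} u \<partial>lborel)"
    by (subst emeasure_density) (auto simp: ennreal_indicator mult.commute)
  also have "\<dots> = (\<integral>\<^sup>+x. indicator A (exp (- (e * x))) * ennreal (e * exp (- (e * x))) \<partial>lborel)"
    by (rule nn_integral_exp_substitution[OF _ e]) measurable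
  also have "\<dots> = emeasure (distr (density lborel (\<lambda>x. ennreal (e * exp (- (e * x))))) borel (\<lambda>x. exp (- (e * x)))) A"
    by (simp add: nn_integral_distr nn_integral_density mult.commute flip: nn_integral_indicator)
  finally show "emeasure (density lborel (\<lambda>u. ennreal (indicator {0<..} u))) A
     = emeasure (distr (density lborel (\<lambda>x. ennreal (e * exp (- (e * x))))) borel (\<lambda>x. exp (- (e * x)))) A" .
qed simp

lemma integral_exp_substitution:
  fixes f :: "real \<Rightarrow> complex"
  assumes [measurable]: "f \<in> borel_measurable borel" and e: "e > 0"
  shows "(LINT u|lborel. indicator {0<..} u *\<^sub>R f u)
    = (LINT x|lborel. (e * exp (- (e * x))) *\<^sub>R f (exp (- (e * x))))"
proof -
  have "(LINT u|lborel. indicator {0<..} u *\<^sub>R f u) = integral\<^sup>L (density lborel (\<lambda>u. ennreal (indicator {0<..} u))) f"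
    by (rule integral_density[symmetric]) auto
  also have "\<dots> = (LINT x|density lborel (\<lambda>x. ennreal (e * exp (- (e * x)))). f (exp (- (e * x))))"
    unfolding density_exp_substitution[OF e] by (rule integral_distr) auto
  also have "\<dots> = (LINT x|lborel. (e * exp (- (e * x))) *\<^sub>R f (exp (- (e * x))))"
    by (rule integral_density) (use e in auto)
  finally show ?thesis .
qed

text \<open>The Jacobian is strictly positive, so preimages of null sets are null.\<close>

lemma AE_exp_substitution:
  fixes P :: "real \<Rightarrow> bool"
  assumes "AE u in lborel. P u"
  shows "AE x in lborel. P (exp (- x))"
proof -
  obtain N where N: "{u \<in> space lborel. \<not> P u} \<subseteq> N" "emeasure lborel N = 0" "N \<in> sets lborel"
    using assms by (rule AE_E)
  have [measurable]: "N \<in> sets borel" using N(3) by simp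
  have "(\<integral>\<^sup>+x. indicator N (exp (- (1 * x))) * ennreal (1 * exp (- (1 * x))) \<partial>lborel)
      = (\<integral>\<^sup>+u. indicator N u * indicator {0<..} u \<partial>lborel)"
    by (rule nn_integral_exp_substitution[symmetric]) auto
  also have "\<dots> \<le> (\<integral>\<^sup>+u. indicator N u \<partial>lborel)"
    by (intro nn_integral_mono) (auto split: split_indicator)
  also have "\<dots> = 0" using N by simp
  finally have "(\<integral>\<^sup>+x. indicator N (exp (- x)) * ennreal (exp (- x)) \<partial>lborel) = 0" by simp
  then have "AE x in lborel. indicator N (exp (- x)) * ennreal (exp (- x)) = 0"
    by (subst (asm) nn_integral_0_iff_AE) auto
  then show ?thesis
  proof eventually_elim
    case (elim x)
    then have "exp (- x) \<notin> N" by (auto simp: indicator_def)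
    then show ?case using N(1) by auto
  qed
qed

section \<open>\<open>T1\<close> as an isometry and its inverse\<close>

lemma T1_eq: "T1 f x = of_real (sqrt (exp (- x))) * \<F> f (exp (- x))"
  by (simp add: T1_def S1_def S2_def S3_def)

text \<open>The weight of \<open>S2\<close> is the square root of the Jacobian of u = exp (-x);
  squaring produces exactly the Jacobian.\<close>

lemma cmod_T1_square: "(cmod (T1 f x))\<^sup>2 = (cmod (\<F> f (exp (- x))))\<^sup>2 * exp (- x)"
  by (simp add: T1_eq norm_mult power_mult_distrib)

lemma square_integrable_T1 [simp]:
  assumes f: "square_integrable lborel f"
  shows "square_integrable lborel (T1 f)"
proof (rule square_integrableI_nn)
  have F: "square_integrable lborel (\<F> f)" using f by simp
  then have [measurable]: "\<F> f \<in> borel_measurable borel"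
    using square_integrable_measurable by fastforce
  show "T1 f \<in> borel_measurable lborel" unfolding T1_eq[abs_def] by measurable
  have "(\<integral>\<^sup>+x. ennreal ((cmod (T1 f x))\<^sup>2) \<partial>lborel)
      = (\<integral>\<^sup>+x. ennreal ((cmod (\<F> f (exp (- (1 * x)))))\<^sup>2) * ennreal (1 * exp (- (1 * x))) \<partial>lborel)"
    by (simp add: cmod_T1_square ennreal_mult)
  also have "\<dots> = (\<integral>\<^sup>+u. ennreal ((cmod (\<F> f u))\<^sup>2) * indicator {0<..} u \<partial>lborel)"
    by (rule nn_integral_exp_substitution[symmetric]) auto
  also have "\<dots> \<le> (\<integral>\<^sup>+u. ennreal ((cmod (\<F> f u))\<^sup>2) \<partial>lborel)"
    by (intro nn_integral_mono) (auto split: split_indicator)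
  also have "\<dots> < \<infinity>" by (simp add: nn_integral_sqnorm[OF F])
  finally show "(\<integral>\<^sup>+x. ennreal ((cmod (T1 f x))\<^sup>2) \<partial>lborel) < \<infinity>" .
qed

lemma T1_surjective:
  assumes g: "square_integrable lborel g"
  shows "\<exists>h. h \<in> \<H> \<and> (AE x in lborel. T1 h x = g x)"
proof -
  have [measurable]: "g \<in> borel_measurable borel" using square_integrable_measurable[OF g] by simp
  \<comment> \<open>Solves \<open>S3 (S2 G) = g\<close> on the positive half-line. Extension by zero
    places the preimage in \<open>\<H>\<close>.\<close>
  define G where "G w = (if w > 0 then g (- ln w) / of_real (sqrt w) else 0)" for w
  have [measurable]: "G \<in> borel_measurable borel" unfolding G_def by measurable
  have G_exp: "(cmod (G (exp (- x))))\<^sup>2 * exp (- x) = (cmod (g x))\<^sup>2" for x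
    by (simp add: G_def norm_divide power_divide)
  have "(\<integral>\<^sup>+w. ennreal ((cmod (G w))\<^sup>2) \<partial>lborel) = (\<integral>\<^sup>+w. ennreal ((cmod (G w))\<^sup>2) * indicator {0<..} w \<partial>lborel)"
    by (intro nn_integral_cong) (simp add: G_def indicator_def)
  also have "\<dots> = (\<integral>\<^sup>+x. ennreal ((cmod (G (exp (- (1 * x)))))\<^sup>2) * ennreal (1 * exp (- (1 * x))) \<partial>lborel)"
    by (rule nn_integral_exp_substitution) auto
  also have "\<dots> = ennreal (sqnorm lborel g)"
    by (simp add: G_exp nn_integral_sqnorm[OF g] flip: ennreal_mult)
  finally have G: "square_integrable lborel G" by (intro square_integrableI_nn) auto
  then obtain h where h: "square_integrable lborel h" "AE w in lborel. \<F> h w = G w"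
    using fourier_transform_surjective by blast
  have "h \<in> \<H>" unfolding \<H>_def L2_iff using h by (auto simp: G_def)
  moreover have "AE x in lborel. T1 h x = g x"
    using AE_exp_substitution[OF h(2)]
    by eventually_elim (simp add: T1_eq G_def)
  ultimately show ?thesis by blast
qed

lemma I_op_spec:
  assumes g: "square_integrable lborel g"
  shows "I_op g \<in> \<H>" and "AE x in lborel. T1 (I_op g) x = g x"
  unfolding I_op_def using someI_ex[OF T1_surjective[OF g]] by blast+

lemma braket_eq_inner_L2: "braket f g = inner_L2 lborel f g"
  by (simp add: braket_def inner_L2_def)

text \<open>Only \<open>k\<close> has to lie in \<open>\<H>\<close>: its transform already kills the
  negative frequencies of \<open>f\<close> in the Plancherel integral.\<close>

lemma braket_T1:
  assumes f: "square_integrable lborel f" and k: "k \<in> \<H>"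
  shows "braket f k = inner_L2 lborel (T1 f) (T1 k)"
proof -
  from k have k': "square_integrable lborel k" and neg: "AE w in lborel. w < 0 \<longrightarrow> \<F> k w = 0"
    by (auto simp: \<H>_def L2_iff)
  have [measurable]: "\<F> f \<in> borel_measurable borel" "\<F> k \<in> borel_measurable borel"
    using square_integrable_F[OF f, THEN square_integrable_measurable]
      square_integrable_F[OF k', THEN square_integrable_measurable] by simp_all
  have "braket f k = (LINT w|lborel. cnj (\<F> f w) * \<F> k w)"
    unfolding braket_eq_inner_L2 Plancherel[OF f k', symmetric] by (simp add: inner_L2_def)
  also have "\<dots> = (LINT w|lborel. indicator {0<..} w *\<^sub>R (cnj (\<F> f w) * \<F> k w))"
  proof (rule integral_cong_AE)
    \<comment> \<open>Membership in \<open>\<H>\<close> controls w < 0 only, so the point 0 is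
      discarded as a null set.\<close>
    show "AE w in lborel. cnj (\<F> f w) * \<F> k w = indicator {0<..} w *\<^sub>R (cnj (\<F> f w) * \<F> k w)"
      using neg AE_lborel_singleton[of 0]
    proof eventually_elim
      case (elim w)
      then show ?case by (cases "w > 0") auto
    qed
  qed measurable
  also have "\<dots> = (LINT x|lborel. (1 * exp (- (1 * x))) *\<^sub>R (cnj (\<F> f (exp (- (1 * x)))) * \<F> k (exp (- (1 * x)))))"
    by (rule integral_exp_substitution) auto
  also have "\<dots> = (LINT x|lborel. cnj (T1 f x) * T1 k x)"
  proof (rule Bochner_Integration.integral_cong[OF refl])
    fix x :: real
    have "complex_of_real (exp (- x)) = of_real (sqrt (exp (- x))) * of_real (sqrt (exp (- x)))"
      by (simp flip: of_real_mult)
    then show "(1 * exp (- (1 * x))) *\<^sub>R (cnj (\<F> f (exp (- (1 * x)))) * \<F> k (exp (- (1 * x)))) = cnj (T1 f x) * T1 k x"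
      by (simp add: T1_eq scaleR_conv_of_real del: of_real_mult)
  qed
  finally show ?thesis by (simp add: inner_L2_def)
qed

lemma inner_L2_cong_AE:
  assumes "square_integrable M f" "square_integrable M g" "square_integrable M h"
    and "AE x in M. g x = h x"
  shows "inner_L2 M f g = inner_L2 M f h"
proof -
  note [measurable] = assms(1-3)[THEN square_integrable_measurable]
  show ?thesis unfolding inner_L2_def
    by (rule integral_cong_AE) (measurable, use assms(4) in \<open>eventually_elim, simp\<close>)
qed

lemma braket_I_op:
  assumes f: "square_integrable lborel f" and g: "square_integrable lborel g"
  shows "braket f (I_op g) = inner_L2 lborel (T1 f) g"
proof -
  have "square_integrable lborel (I_op g)" using I_op_spec(1)[OF g] by (simp add: \<H>_def L2_iff)
  then show ?thesis
    unfolding braket_T1[OF f I_op_spec(1)[OF g]]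
    by (intro inner_L2_cong_AE square_integrable_T1 f g I_op_spec(2))
qed

lemma AE_lborel_shift:
  fixes P :: "real \<Rightarrow> bool"
  assumes "AE x in lborel. P x"
  shows "AE x in lborel. P (t + x)"
proof -
  obtain N where N: "{u \<in> space lborel. \<not> P u} \<subseteq> N" "emeasure lborel N = 0" "N \<in> sets lborel"
    using assms by (rule AE_E)
  have [measurable]: "N \<in> sets borel" using N(3) by simp
  have "AE x in lborel. x \<notin> N" using N by (intro AE_not_in) auto
  then have "AE x in lborel. t + 1 * x \<notin> N" by (rule AE_borel_affine[rotated 2]) auto
  then show ?thesis
  proof eventually_elim
    case (elim x)
    then show ?case using N(1) by auto
  qed
qed

lemma square_integrable_shift:
  assumes "square_integrable lborel f"
  shows "square_integrable lborel (\<lambda>x. f (t + x :: real))"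
proof -
  have [measurable]: "f \<in> borel_measurable borel" using square_integrable_measurable[OF assms] by simp
  show ?thesis
    using lborel_integrable_real_affine[OF square_integrableD[OF assms], of 1 t]
    by (simp add: square_integrable_def)
qed

lemma square_integrable_cis_mult:
  assumes "square_integrable lborel f" and [measurable]: "\<theta> \<in> borel_measurable borel"
  shows "square_integrable lborel (\<lambda>x. cis (\<theta> x) * f x)"
proof -
  note [measurable] = square_integrable_measurable[OF assms(1)]
  show ?thesis
    by (rule square_integrable_bound[OF assms(1), where C=1]) (measurable, simp add: norm_mult)
qed

text \<open>Both representations act by a phase times a translation. \<open>T1 (I_op g)\<close>
  agrees with \<open>g\<close> off a null set, translation preserves null sets, and the outer
  \<open>I_op\<close> crosses the pairing as \<open>T1\<close>.\<close>

lemma braket_I_op_phase_shift: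
  assumes f: "square_integrable lborel f" and g: "square_integrable lborel g"
    and \<theta>: "\<theta> \<in> borel_measurable borel"
  shows "braket f (I_op (\<lambda>x. cis (\<theta> x) * T1 (I_op g) (t + x)))
    = (LINT x|lborel. cnj (T1 f x) * g (t + x) * cis (\<theta> x))"
proof -
  have k: "square_integrable lborel (I_op g)" using I_op_spec(1)[OF g] by (simp add: \<H>_def L2_iff)
  have sq: "square_integrable lborel (\<lambda>x. cis (\<theta> x) * T1 (I_op g) (t + x))"
    "square_integrable lborel (\<lambda>x. cis (\<theta> x) * g (t + x))"
    by (intro square_integrable_cis_mult square_integrable_shift square_integrable_T1 k g \<theta>)+
  have "braket f (I_op (\<lambda>x. cis (\<theta> x) * T1 (I_op g) (t + x)))
      = inner_L2 lborel (T1 f) (\<lambda>x. cis (\<theta> x) * g (t + x))"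
    unfolding braket_I_op[OF f sq(1)]
  proof (rule inner_L2_cong_AE[OF square_integrable_T1[OF f] sq])
    show "AE x in lborel. cis (\<theta> x) * T1 (I_op g) (t + x) = cis (\<theta> x) * g (t + x)"
      using AE_lborel_shift[OF I_op_spec(2)[OF g]] by eventually_elim simp
  qed
  then show ?thesis by (simp add: inner_L2_def mult_ac)
qed

lemma sqnorm_shift:
  fixes g :: "real \<Rightarrow> complex"
  assumes "g \<in> borel_measurable borel"
  shows "sqnorm lborel (\<lambda>x. g (t + x)) = sqnorm lborel g"
  unfolding sqnorm_def using lborel_integral_real_affine[of 1 "\<lambda>x. (cmod (g x))\<^sup>2" t] by simp

text \<open>Under the substitution \<open>u = exp (- \<epsilon> y)\<close> the functions below become, up to the Jacobian, the
  characters of the interval from \<open>exp (- \<epsilon> L)\<close> to \<open>exp (\<epsilon> L)\<close>.\<close>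

lemma Parseval_exp_interval:
  assumes k: "square_integrable lborel k" and supp: "AE y in lborel. y \<notin> {-L..L} \<longrightarrow> k y = 0"
    and e: "e > 0" and L: "L > 0"
  defines "l \<equiv> exp (e * L) - exp (- e * L)"
  shows "(\<integral>\<^sup>+m. ennreal ((cmod (LINT y|lborel. k y * Q e y *
      cis (- (2 * pi * of_int m * exp (- (e * y)) / l))))\<^sup>2) \<partial>count_space UNIV)
    = ennreal (l / e * sqnorm lborel k)"
proof -
  have l: "l > 0" using e L by (simp add: l_def)
  have [measurable]: "k \<in> borel_measurable borel" using square_integrable_measurable[OF k] by simp
  \<comment> \<open>Makes the vanishing outside [-L, L] hold everywhere, so that the support of
    \<open>K\<close> can be read off pointwise.\<close>
  define k' where "k' y = indicator {-L..L} y * k y" for y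
  have [measurable]: "k' \<in> borel_measurable borel" unfolding k'_def by measurable
  have k'_eq: "AE y in lborel. k' y = k y"
    using supp by eventually_elim (auto simp: k'_def indicator_def)
  have norm_k': "(\<integral>\<^sup>+y. ennreal ((cmod (k' y))\<^sup>2) \<partial>lborel) = ennreal (sqnorm lborel k)"
    unfolding nn_integral_sqnorm[OF k, symmetric]
    by (rule nn_integral_cong_AE) (use k'_eq in \<open>eventually_elim, simp\<close>)
  \<comment> \<open>With u = exp (- e y) one has Q = sqrt u and dy = du / (e u) up to orientation,
    so k Q dy becomes k / (e sqrt u) du.\<close>
  define K where "K u = (if u > 0 then k' (- ln u / e) / of_real (e * sqrt u) else 0)" for u
  have [measurable]: "K \<in> borel_measurable borel" unfolding K_def by measurable
  have K_exp: "K (exp (- (e * y))) = k' y / of_real (e * sqrt (exp (- (e * y))))" for y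
    using e by (simp add: K_def)
  have K2: "(cmod (K (exp (- (e * y)))))\<^sup>2 * (e * exp (- (e * y))) = 1 / e * (cmod (k' y))\<^sup>2" for y
  proof -
    have "(cmod (K (exp (- (e * y)))))\<^sup>2 = (cmod (k' y))\<^sup>2 / (e\<^sup>2 * exp (- (e * y)))"
      unfolding K_exp by (simp add: norm_divide norm_mult power_divide power_mult_distrib)
    then show ?thesis using e by (simp add: field_simps power2_eq_square[of e])
  qed
  have nnK: "(\<integral>\<^sup>+u. ennreal ((cmod (K u))\<^sup>2) \<partial>lborel) = ennreal (1 / e * sqnorm lborel k)"
  proof -
    have "(\<integral>\<^sup>+u. ennreal ((cmod (K u))\<^sup>2) \<partial>lborel) = (\<integral>\<^sup>+u. ennreal ((cmod (K u))\<^sup>2) * indicator {0<..} u \<partial>lborel)"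
      by (intro nn_integral_cong) (simp add: K_def indicator_def)
    also have "\<dots> = (\<integral>\<^sup>+y. ennreal ((cmod (K (exp (- (e * y)))))\<^sup>2) * ennreal (e * exp (- (e * y))) \<partial>lborel)"
      by (rule nn_integral_exp_substitution[OF _ e]) measurable
    also have "\<dots> = (\<integral>\<^sup>+y. ennreal (1 / e) * ennreal ((cmod (k' y))\<^sup>2) \<partial>lborel)"
    proof (rule nn_integral_cong)
      fix y
      have "ennreal ((cmod (K (exp (- (e * y)))))\<^sup>2) * ennreal (e * exp (- (e * y)))
          = ennreal ((cmod (K (exp (- (e * y)))))\<^sup>2 * (e * exp (- (e * y))))"
        using e by (intro ennreal_mult[symmetric]) auto
      also have "\<dots> = ennreal (1 / e) * ennreal ((cmod (k' y))\<^sup>2)"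
        unfolding K2 using e by (intro ennreal_mult) auto
      finally show "ennreal ((cmod (K (exp (- (e * y)))))\<^sup>2) * ennreal (e * exp (- (e * y)))
          = ennreal (1 / e) * ennreal ((cmod (k' y))\<^sup>2)" .
    qed
    also have "\<dots> = ennreal (1 / e) * ennreal (sqnorm lborel k)"
      by (subst nn_integral_cmult) (simp_all only: norm_k', measurable)
    also have "\<dots> = ennreal (1 / e * sqnorm lborel k)"
      using e by (intro ennreal_mult[symmetric]) auto
    finally show ?thesis .
  qed
  have K: "square_integrable lborel K"
    by (rule square_integrableI_nn) (simp_all only: nnK, simp_all)
  have norm_K: "sqnorm lborel K = 1 / e * sqnorm lborel k"
    using nnK e by (simp add: nn_integral_sqnorm[OF K])
  have supp_K: "AE u in lborel. u \<notin> {exp (- e * L)..exp (- e * L) + l} \<longrightarrow> K u = 0"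
  proof (rule AE_I2, rule impI)
    fix u assume u: "u \<notin> {exp (- e * L)..exp (- e * L) + l}"
    show "K u = 0"
    proof (cases "u > 0")
      case True
      have "- ln u / e \<notin> {-L..L}"
      proof
        assume "- ln u / e \<in> {-L..L}"
        then have "- e * L \<le> ln u" "ln u \<le> e * L" using e by (auto simp: field_simps)
        then have "exp (- e * L) \<le> exp (ln u)" "exp (ln u) \<le> exp (e * L)"
          by (simp_all only: exp_le_cancel_iff)
        then show False using u True by (simp add: l_def)
      qed
      then show ?thesis by (simp add: K_def k'_def)
    qed (simp add: K_def)
  qed
  have coeff: "(LINT y|lborel. k y * Q e y * cis (- (2 * pi * of_int m * exp (- (e * y)) / l)))
      = (LINT u|lborel. K u * cis (- (2 * pi * of_int m * u / l)))" for m
  proof -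
    have "(LINT u|lborel. K u * cis (- (2 * pi * of_int m * u / l)))
        = (LINT u|lborel. indicator {0<..} u *\<^sub>R (K u * cis (- (2 * pi * of_int m * u / l))))"
      by (intro Bochner_Integration.integral_cong refl) (simp add: K_def indicator_def)
    also have "\<dots> = (LINT y|lborel. (e * exp (- (e * y))) *\<^sub>R
        (K (exp (- (e * y))) * cis (- (2 * pi * of_int m * exp (- (e * y)) / l))))"
      by (rule integral_exp_substitution[OF _ e]) measurable
    also have "\<dots> = (LINT y|lborel. k y * Q e y * cis (- (2 * pi * of_int m * exp (- (e * y)) / l)))"
    proof (rule integral_cong_AE)
      show "AE y in lborel. (e * exp (- (e * y))) *\<^sub>R
          (K (exp (- (e * y))) * cis (- (2 * pi * of_int m * exp (- (e * y)) / l)))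
        = k y * Q e y * cis (- (2 * pi * of_int m * exp (- (e * y)) / l))"
        using k'_eq
      proof eventually_elim
        case (elim y)
        have Q: "Q e y = sqrt (exp (- (e * y)))"
          by (rule real_sqrt_unique[symmetric]) (simp_all add: Q_def power2_eq_square flip: exp_add)
        have s: "complex_of_real (exp (- (e * y))) = of_real (sqrt (exp (- (e * y)))) * of_real (sqrt (exp (- (e * y))))"
          by (simp flip: of_real_mult)
        have "of_real (e * exp (- (e * y))) * K (exp (- (e * y))) = k y * Q e y"
          unfolding K_exp Q elim of_real_mult s using e by simp
        then show ?case by (simp only: scaleR_conv_of_real mult.assoc[symmetric])
      qed
    qed (unfold Q_def, measurable)
    finally show ?thesis by (rule sym)
  qed
  show ?thesis
    unfolding coeff Parseval_interval[OF K l supp_K] norm_K by simp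
qed

text \<open>The step shared by both families: \<open>C\<close> comes from Parseval in
  \<open>m\<close>, \<open>chi\<close> from Tonelli and periodization in \<open>n\<close>.
  Assumption \<open>F\<close> may presuppose square-integrable slices, because the proof derives
  that property from \<open>per\<close>.\<close>

lemma has_sum_frame:
  fixes F :: "int \<Rightarrow> int \<Rightarrow> complex" and h \<psi> :: "real \<Rightarrow> complex"
  assumes h: "square_integrable lborel h" and \<psi>: "square_integrable lborel \<psi>" and C: "C \<ge> 0" and chi: "chi \<ge> 0"
    and per: "AE x in lborel. ((\<lambda>n::int. (cmod (\<psi> (x + of_int n * q0)))\<^sup>2) has_sum chi) UNIV"
    and F: "\<And>n. square_integrable lborel (\<lambda>x. cnj (h x) * \<psi> (of_int n * q0 + x)) \<Longrightarrow>
      (\<integral>\<^sup>+m. ennreal ((cmod (F n m))\<^sup>2) \<partial>count_space UNIV)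
        = ennreal (C * sqnorm lborel (\<lambda>x. cnj (h x) * \<psi> (of_int n * q0 + x)))"
  shows "((\<lambda>(n, m). (cmod (F n m))\<^sup>2) has_sum C * chi * sqnorm lborel h) UNIV"
proof -
  have [measurable]: "h \<in> borel_measurable borel" "\<psi> \<in> borel_measurable borel"
    using square_integrable_measurable[OF h] square_integrable_measurable[OF \<psi>] by simp_all
  let ?g = "\<lambda>n::int. \<lambda>x. cnj (h x) * \<psi> (of_int n * q0 + x)"
  \<comment> \<open>A single term of the periodization sum is at most \<open>chi\<close>, so the
    translate of \<open>\<psi>\<close> is essentially bounded.\<close>
  have g: "square_integrable lborel (?g n)" for n
  proof (rule square_integrable_bound[OF h, where C="sqrt chi"])
    show "AE x in lborel. cmod (?g n x) \<le> sqrt chi * cmod (h x)"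
      using per
    proof eventually_elim
      case (elim x)
      have "(\<Sum>n\<in>{n}. (cmod (\<psi> (x + of_int n * q0)))\<^sup>2) \<le> chi"
        by (rule finite_sum_le_has_sum[OF elim]) auto
      then have "cmod (\<psi> (x + of_int n * q0)) \<le> sqrt chi" by (intro real_le_rsqrt) simp
      from mult_left_mono[OF this, of "cmod (h x)"] show ?case
        by (simp add: norm_mult mult.commute add.commute)
    qed
  qed measurable
  have "(\<integral>\<^sup>+p. ennreal (case p of (n, m) \<Rightarrow> (cmod (F n m))\<^sup>2) \<partial>count_space UNIV)
      = (\<integral>\<^sup>+n. (\<integral>\<^sup>+m. ennreal ((cmod (F n m))\<^sup>2) \<partial>count_space UNIV) \<partial>count_space UNIV)"
    by (subst nn_integral_fst_count_space[symmetric]) simp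
  also have "\<dots> = (\<integral>\<^sup>+n. ennreal C * (\<integral>\<^sup>+x. ennreal ((cmod (?g n x))\<^sup>2) \<partial>lborel) \<partial>count_space UNIV)"
    using C by (intro nn_integral_cong) (simp only: F[OF g] nn_integral_sqnorm[OF g] ennreal_mult sqnorm_nonneg)
  also have "\<dots> = ennreal C * (\<integral>\<^sup>+n. (\<integral>\<^sup>+x. ennreal ((cmod (?g n x))\<^sup>2) \<partial>lborel) \<partial>count_space UNIV)"
    by (rule nn_integral_cmult) simp
  also have "(\<integral>\<^sup>+n. (\<integral>\<^sup>+x. ennreal ((cmod (?g n x))\<^sup>2) \<partial>lborel) \<partial>count_space (UNIV :: int set))
      = (\<integral>\<^sup>+x. (\<integral>\<^sup>+n. ennreal ((cmod (?g n x))\<^sup>2) \<partial>count_space UNIV) \<partial>lborel)"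
    by (rule nn_integral_count_space_nn_integral[symmetric]) auto
  also have "\<dots> = (\<integral>\<^sup>+x. ennreal chi * ennreal ((cmod (h x))\<^sup>2) \<partial>lborel)"
  proof (rule nn_integral_cong_AE)
    show "AE x in lborel. (\<integral>\<^sup>+n. ennreal ((cmod (?g n x))\<^sup>2) \<partial>count_space UNIV) = ennreal chi * ennreal ((cmod (h x))\<^sup>2)"
      using per
    proof eventually_elim
      case (elim x)
      have "(\<integral>\<^sup>+n. ennreal ((cmod (?g n x))\<^sup>2) \<partial>count_space UNIV)
          = (\<integral>\<^sup>+n. ennreal ((cmod (\<psi> (x + of_int n * q0)))\<^sup>2) * ennreal ((cmod (h x))\<^sup>2) \<partial>count_space UNIV)"
        by (intro nn_integral_cong) (simp add: norm_mult power_mult_distrib mult.commute add.commute flip: ennreal_mult)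
      also have "\<dots> = (\<integral>\<^sup>+n. ennreal ((cmod (\<psi> (x + of_int n * q0)))\<^sup>2) \<partial>count_space UNIV) * ennreal ((cmod (h x))\<^sup>2)"
        by (rule nn_integral_multc) simp
      also have "(\<integral>\<^sup>+n. ennreal ((cmod (\<psi> (x + of_int n * q0)))\<^sup>2) \<partial>count_space (UNIV :: int set)) = ennreal chi"
        using elim chi by (subst nn_integral_count_space_iff_has_sum) auto
      finally show ?case .
    qed
  qed
  also have "\<dots> = ennreal chi * ennreal (sqnorm lborel h)"
    by (subst nn_integral_cmult) (simp_all only: nn_integral_sqnorm[OF h], measurable)
  also have "ennreal C * (ennreal chi * ennreal (sqnorm lborel h)) = ennreal (C * chi * sqnorm lborel h)"
    using C chi by (simp add: ennreal_mult mult.assoc)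
  finally show ?thesis
    by (rule iffD1[OF nn_integral_count_space_iff_has_sum, rotated 2]) (use C chi in \<open>auto split: prod.split\<close>)
qed

section \<open>Both coefficient families as Fourier coefficients\<close>

lemma braket_\<psi>_heis:
  assumes "square_integrable lborel f" "square_integrable lborel \<psi>" "A \<noteq> 0" "L > 0" "p0 = pi / (A * L)"
  shows "cmod (braket f (\<psi>_heis A B q0 p0 \<psi> n m))
    = cmod (LINT x|lborel. cnj (cnj (T1 f x) * \<psi> (of_int n * q0 + x)) * cis (- (2 * pi * of_int m * x / (2 * L))))"
proof -
  \<comment> \<open>Gathers the phase independent of \<open>x\<close>, which leaves the integral as
    a unimodular factor. The rest is A x m p0 = pi m x / L, a frequency of an interval of length 2
    L.\<close>
  define c where "c = A * (of_int n * q0 * of_int m * p0 / 2) + B * (of_int m * p0)"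
  have \<theta>: "A * (of_int n * q0 * of_int m * p0 / 2 + x * (of_int m * p0)) + B * (of_int m * p0)
      = c + 2 * pi * of_int m * x / (2 * L)" for x
    using assms(3,4) by (simp add: c_def assms(5) field_simps)
  have "braket f (\<psi>_heis A B q0 p0 \<psi> n m)
      = braket f (I_op (\<lambda>x. cis (c + 2 * pi * of_int m * x / (2 * L)) * T1 (I_op \<psi>) (of_int n * q0 + x)))"
    unfolding \<psi>_heis_def \<eta>_tilde_def o_apply \<eta>.simps \<theta> ..
  also have "\<dots> = (LINT x|lborel. cnj (T1 f x) * \<psi> (of_int n * q0 + x) * cis (c + 2 * pi * of_int m * x / (2 * L)))"
    by (rule braket_I_op_phase_shift[OF assms(1,2)]) measurable
  \<comment> \<open>Conjugating the integral flips the frequency to the sign used by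
    \<open>Parseval_interval\<close> and preserves the modulus.\<close>
  also have "\<dots> = (LINT x|lborel. cis c * cnj (cnj (cnj (T1 f x) * \<psi> (of_int n * q0 + x))
      * cis (- (2 * pi * of_int m * x / (2 * L)))))"
    by (intro Bochner_Integration.integral_cong refl) (simp add: cis_cnj mult_ac flip: cis_mult)
  also have "\<dots> = cis c * cnj (LINT x|lborel. cnj (cnj (T1 f x) * \<psi> (of_int n * q0 + x))
      * cis (- (2 * pi * of_int m * x / (2 * L))))"
    by (simp only: integral_mult_right_zero Bochner_Integration.integral_cnj)
  finally show ?thesis by (simp only: norm_mult norm_cis complex_mod_cnj mult_1)
qed

lemma braket_\<psi>_aff:
  assumes f: "square_integrable lborel f" and \<psi>: "square_integrable lborel (\<lambda>x. of_real (Q \<epsilon> x) * \<psi> x)"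
    and "\<epsilon> > 0" "b \<noteq> 0"
  shows "cmod (braket f (\<psi>_aff L q0 \<epsilon> a b \<psi> n m))
    = cmod (LINT y|lborel. (cnj (T1 f (y - of_int n * q0)) * \<psi> y) * Q \<epsilon> y *
      cis (- (2 * pi * of_int m * exp (- (\<epsilon> * y)) / (exp (\<epsilon> * L) - exp (- \<epsilon> * L)))))"
proof -
  define l where "l = exp (\<epsilon> * L) - exp (- \<epsilon> * L)"
  define t where "t = of_int n * q0"
  define c where "c = a * \<gamma>_par L q0 b \<epsilon> n m"
  define \<theta> where "\<theta> y = - (2 * pi * of_int m * exp (- (\<epsilon> * y)) / l)" for y
  have [measurable]: "\<theta> \<in> borel_measurable borel" unfolding \<theta>_def by measurable
  \<comment> \<open>The factor exp (- \<epsilon> n q0) in \<open>\<beta>_par\<close> combines with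
    exp (- \<epsilon> x), so the phase depends on \<open>x\<close> only through t + x; its
    denominator cancels \<open>b\<close>.\<close>
  have ph: "b * \<beta>_par L q0 b \<epsilon> n m * exp (- \<epsilon> * x) = \<theta> (t + x)" for x
  proof -
    have "exp (- (\<epsilon> * (t + x))) = exp (- \<epsilon> * of_int n * q0) * exp (- \<epsilon> * x)"
      by (simp add: t_def algebra_simps flip: exp_add)
    then show ?thesis using \<open>b \<noteq> 0\<close> by (simp add: \<theta>_def \<beta>_par_def l_def)
  qed
  have sh: "x - ln (\<alpha>_par q0 \<epsilon> n) / \<epsilon> = t + x" for x
    using \<open>\<epsilon> > 0\<close> by (simp add: \<alpha>_par_def t_def)
  have "braket f (\<psi>_aff L q0 \<epsilon> a b \<psi> n m)
      = braket f (I_op (\<lambda>x. cis (c + \<theta> (t + x)) * T1 (I_op (\<lambda>x. of_real (Q \<epsilon> x) * \<psi> x)) (t + x)))"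
    unfolding \<psi>_aff_def \<pi>_rep_def o_apply \<rho>.simps ph sh c_def[symmetric] cis_mult ..
  also have "\<dots> = (LINT x|lborel. cnj (T1 f x) * (of_real (Q \<epsilon> (t + x)) * \<psi> (t + x)) * cis (c + \<theta> (t + x)))"
    by (rule braket_I_op_phase_shift[OF f \<psi>]) measurable
  \<comment> \<open>Everything is a function of y = t + x. The change of variables moves the
    translation from \<open>\<psi>\<close> to \<open>T1 f\<close>, so one window serves all
    \<open>n\<close>.\<close>
  also have "\<dots> = (LINT x|lborel. cis c * ((cnj (T1 f (t + 1 * x - t)) * \<psi> (t + 1 * x)) * Q \<epsilon> (t + 1 * x) * cis (\<theta> (t + 1 * x))))"
    by (intro Bochner_Integration.integral_cong refl) (simp add: mult_ac flip: cis_mult)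
  also have "\<dots> = cis c * (LINT y|lborel. (cnj (T1 f (y - t)) * \<psi> y) * Q \<epsilon> y * cis (\<theta> y))"
    using lborel_integral_real_affine[of 1 "\<lambda>y. (cnj (T1 f (y - t)) * \<psi> y) * Q \<epsilon> y * cis (\<theta> y)" t]
    by (simp only: integral_mult_right_zero) simp
  finally show ?thesis by (simp add: norm_mult \<theta>_def l_def t_def)
qed

theorem has_sum_heis:
  assumes f: "square_integrable lborel f" and \<psi>: "square_integrable lborel \<psi>"
    and "A \<noteq> 0" and L: "L > 0" and "p0 = pi / (A * L)" and chi: "chi \<ge> 0"
    and supp: "AE x in lborel. x \<notin> {-L..L} \<longrightarrow> \<psi> x = 0"
    and per: "AE x in lborel. ((\<lambda>n::int. (cmod (\<psi> (x + of_int n * q0)))\<^sup>2) has_sum chi) UNIV"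
  shows "((\<lambda>(n, m). (cmod (braket f (\<psi>_heis A B q0 p0 \<psi> n m)))\<^sup>2)
    has_sum 2 * L * chi * sqnorm lborel (T1 f)) UNIV"
proof (rule has_sum_frame[OF square_integrable_T1[OF f] \<psi> _ chi per])
  fix n :: int
  let ?g = "\<lambda>x. cnj (T1 f x) * \<psi> (of_int n * q0 + x)"
  assume g: "square_integrable lborel ?g"
  \<comment> \<open>Here the window travels with \<open>n\<close>, but its length 2 L is
    constant.\<close>
  have "AE x in lborel. x \<notin> {- L - of_int n * q0..- L - of_int n * q0 + 2 * L} \<longrightarrow> cnj (?g x) = 0"
    using AE_lborel_shift[OF supp, of "of_int n * q0"] by eventually_elim auto
  from Parseval_interval[OF square_integrable_cnj[OF g] _ this]
  show "(\<integral>\<^sup>+m. ennreal ((cmod (braket f (\<psi>_heis A B q0 p0 \<psi> n m)))\<^sup>2) \<partial>count_space UNIV)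
      = ennreal (2 * L * sqnorm lborel ?g)"
    using L unfolding braket_\<psi>_heis[OF f \<psi> assms(3-5)] sqnorm_cnj by simp
qed (use L in simp)

theorem has_sum_aff:
  assumes f: "square_integrable lborel f" and \<psi>: "square_integrable lborel \<psi>"
    and e: "\<epsilon> > 0" and b: "b \<noteq> 0" and L: "L > 0" and chi: "chi \<ge> 0"
    and supp: "AE x in lborel. x \<notin> {-L..L} \<longrightarrow> \<psi> x = 0"
    and per: "AE x in lborel. ((\<lambda>n::int. (cmod (\<psi> (x + of_int n * q0)))\<^sup>2) has_sum chi) UNIV"
  shows "((\<lambda>(n, m). (cmod (braket f (\<psi>_aff L q0 \<epsilon> a b \<psi> n m)))\<^sup>2)
    has_sum (exp (\<epsilon> * L) - exp (- \<epsilon> * L)) / \<epsilon> * chi * sqnorm lborel (T1 f)) UNIV"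
proof (rule has_sum_frame[OF square_integrable_T1[OF f] \<psi> _ chi per])
  have [measurable]: "\<psi> \<in> borel_measurable borel" "T1 f \<in> borel_measurable borel"
    using square_integrable_measurable[OF \<psi>] square_integrable_measurable[OF square_integrable_T1[OF f]] by simp_all
  \<comment> \<open>\<open>Q \<epsilon>\<close> is unbounded on the line; on the support of
    \<open>\<psi>\<close> it is at most exp (\<epsilon> L / 2).\<close>
  have Q\<psi>: "square_integrable lborel (\<lambda>x. of_real (Q \<epsilon> x) * \<psi> x)"
  proof (rule square_integrable_bound[OF \<psi>, where C="exp (\<epsilon> * L / 2)"])
    show "AE x in lborel. cmod (of_real (Q \<epsilon> x) * \<psi> x) \<le> exp (\<epsilon> * L / 2) * cmod (\<psi> x)"
      using supp
    proof eventually_elim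
      case (elim x)
      show ?case
      proof (cases "x \<in> {-L..L}")
        case True
        then have "Q \<epsilon> x \<le> exp (\<epsilon> * L / 2)"
          using mult_left_mono[of "- x" L \<epsilon>] e by (simp add: Q_def)
        then show ?thesis
          by (simp add: norm_mult Q_def mult_right_mono)
      qed (use elim in simp)
    qed
  qed (unfold Q_def, measurable)
  fix n :: int
  let ?t = "of_int n * q0"
  let ?g = "\<lambda>x. cnj (T1 f x) * \<psi> (?t + x)"
  let ?k = "\<lambda>y. cnj (T1 f (y - ?t)) * \<psi> y"
  assume g: "square_integrable lborel ?g"
  have k: "square_integrable lborel ?k"
    using square_integrable_shift[OF g, of "- ?t"] by simp
  have norm: "sqnorm lborel ?k = sqnorm lborel ?g"
    using sqnorm_shift[of ?g "- ?t"] by simp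
  have "AE y in lborel. y \<notin> {-L..L} \<longrightarrow> ?k y = 0"
    using supp by eventually_elim simp
  from Parseval_exp_interval[OF k this e L]
  show "(\<integral>\<^sup>+m. ennreal ((cmod (braket f (\<psi>_aff L q0 \<epsilon> a b \<psi> n m)))\<^sup>2) \<partial>count_space UNIV)
      = ennreal ((exp (\<epsilon> * L) - exp (- \<epsilon> * L)) / \<epsilon> * sqnorm lborel ?g)"
    unfolding norm braket_\<psi>_aff[OF f Q\<psi> e b] .
qed (use e L in simp)

text \<open>The numerator vanishes at 0, so the quotient tends to its derivative there.\<close>

lemma tendsto_exp_difference_quotient:
  "((\<lambda>\<epsilon>. (exp (\<epsilon> * L) - exp (- \<epsilon> * L)) / \<epsilon>) \<longlongrightarrow> 2 * L) (at_right (0::real))"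
proof -
  have "((\<lambda>\<epsilon>. exp (\<epsilon> * L) - exp (- \<epsilon> * L)) has_field_derivative 2 * L) (at 0)"
    by (auto intro!: derivative_eq_intros)
  then have "((\<lambda>\<epsilon>. (exp (\<epsilon> * L) - exp (- \<epsilon> * L)) / \<epsilon>) \<longlongrightarrow> 2 * L) (at 0)"
    unfolding has_field_derivative_iff by simp
  then show ?thesis by (rule tendsto_mono[OF at_le, rotated]) simp
qed

text \<open>An infinite sum defaults to 0 when it does not converge; the summability conjuncts
  certify that the sums in the limit are genuine. Support and periodization are assumed almost
  everywhere, as befits L2 classes.\<close>

theorem corollaryV1:
  fixes A B a0 b0 L p0 q0 chi :: real
    and a b :: "real \<Rightarrow> real"
    and \<psi> f :: "real \<Rightarrow> complex"
  assumes "A \<noteq> 0"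
    and "a0 + b0 = B"
    and "\<And>\<epsilon>. \<epsilon> \<in> {0<..1} \<Longrightarrow> a \<epsilon> = a0 + A / \<epsilon>"
    and "\<And>\<epsilon>. \<epsilon> \<in> {0<..1} \<Longrightarrow> b \<epsilon> = b0 - A / \<epsilon>"
    and "\<And>\<epsilon>. \<epsilon> \<in> {0<..1} \<Longrightarrow> b \<epsilon> \<noteq> 0"
    and "L > 0"
    and "\<psi> \<in> L2"
    and "\<not> (AE x in lborel. \<psi> x = 0)"
    and "AE x in lborel. x \<notin> {-L..L} \<longrightarrow> \<psi> x = 0"
    and "p0 = pi / (A * L)"
    and "\<bar>q0 * p0\<bar> < 2 * pi"
    and "chi > 0"
    and "AE x in lborel. ((\<lambda>n::int. (cmod (\<psi> (x + of_int n * q0)))\<^sup>2) has_sum chi) UNIV"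
    and "f \<in> L2"
  shows "(\<forall>\<epsilon>\<in>{0<..1}. (\<lambda>(n, m). (cmod (braket f (\<psi>_aff L q0 \<epsilon> (a \<epsilon>) (b \<epsilon>) \<psi> n m)))\<^sup>2)
            summable_on (UNIV :: (int \<times> int) set))
       \<and> (\<lambda>(n, m). (cmod (braket f (\<psi>_heis A B q0 p0 \<psi> n m)))\<^sup>2)
            summable_on (UNIV :: (int \<times> int) set)
       \<and> ((\<lambda>\<epsilon>. \<Sum>\<^sub>\<infinity>(n, m)\<in>UNIV. (cmod (braket f (\<psi>_aff L q0 \<epsilon> (a \<epsilon>) (b \<epsilon>) \<psi> n m)))\<^sup>2)
            \<longlongrightarrow> (\<Sum>\<^sub>\<infinity>(n, m)\<in>UNIV. (cmod (braket f (\<psi>_heis A B q0 p0 \<psi> n m)))\<^sup>2)) (at_right 0)"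
proof (intro conjI ballI)
  have f: "square_integrable lborel f" and \<psi>: "square_integrable lborel \<psi>"
    using assms(7,14) by (simp_all add: L2_iff)
  have chi: "chi \<ge> 0" using assms(12) by simp
  note heis = has_sum_heis[OF f \<psi> assms(1,6,10) chi assms(9,13), of B]
  have aff: "((\<lambda>(n, m). (cmod (braket f (\<psi>_aff L q0 \<epsilon> (a \<epsilon>) (b \<epsilon>) \<psi> n m)))\<^sup>2)
    has_sum (exp (\<epsilon> * L) - exp (- \<epsilon> * L)) / \<epsilon> * chi * sqnorm lborel (T1 f)) UNIV"
    if "\<epsilon> \<in> {0<..1}" for \<epsilon>
    using that by (intro has_sum_aff[OF f \<psi> _ assms(5)[OF that] assms(6) chi assms(9,13)]) simp
  show "(\<lambda>(n, m). (cmod (braket f (\<psi>_aff L q0 \<epsilon> (a \<epsilon>) (b \<epsilon>) \<psi> n m)))\<^sup>2)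
      summable_on (UNIV :: (int \<times> int) set)" if "\<epsilon> \<in> {0<..1}" for \<epsilon>
    using aff[OF that] by (rule has_sum_imp_summable)
  show "(\<lambda>(n, m). (cmod (braket f (\<psi>_heis A B q0 p0 \<psi> n m)))\<^sup>2) summable_on (UNIV :: (int \<times> int) set)"
    using heis by (rule has_sum_imp_summable)
  have "((\<lambda>\<epsilon>. (exp (\<epsilon> * L) - exp (- \<epsilon> * L)) / \<epsilon> * chi * sqnorm lborel (T1 f))
      \<longlongrightarrow> 2 * L * chi * sqnorm lborel (T1 f)) (at_right 0)"
    by (intro tendsto_intros tendsto_exp_difference_quotient)
  \<comment> \<open>The closed form is available only for \<epsilon> in (0, 1], and a right
    neighbourhood of 0 suffices for the limit.\<close>
  moreover have "\<forall>\<^sub>F \<epsilon> in at_right 0.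
      (exp (\<epsilon> * L) - exp (- \<epsilon> * L)) / \<epsilon> * chi * sqnorm lborel (T1 f)
      = (\<Sum>\<^sub>\<infinity>(n, m)\<in>UNIV. (cmod (braket f (\<psi>_aff L q0 \<epsilon> (a \<epsilon>) (b \<epsilon>) \<psi> n m)))\<^sup>2)"
    using eventually_at_right_real[of 0 1]
    by (rule eventually_mono) (simp_all add: infsumI[OF aff])
  ultimately show "((\<lambda>\<epsilon>. \<Sum>\<^sub>\<infinity>(n, m)\<in>UNIV. (cmod (braket f (\<psi>_aff L q0 \<epsilon> (a \<epsilon>) (b \<epsilon>) \<psi> n m)))\<^sup>2)
      \<longlongrightarrow> (\<Sum>\<^sub>\<infinity>(n, m)\<in>UNIV. (cmod (braket f (\<psi>_heis A B q0 p0 \<psi> n m)))\<^sup>2)) (at_right 0)"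
    unfolding infsumI[OF heis] by (rule Lim_transform_eventually)
qed

end
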